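(* Let $\alpha\in(1,2)$, let $a:\mathbb{R}\to(0,\infty)$ be continuous with $\int_{\mathbb{R}}a(x)^{-1}\mathrm{d}x=1$, and let $\mu(\mathrm{d}x)=a(x)^{-1}\mathrm{d}x$. Let $(\mathscr{E},\mathscr{F})$ be the Dirichlet form of the time-changed symmetric $\alpha$-stable process $Y$ with generator $a(x)\Delta^{\alpha/2}$. Then the super-Poincaré inequality holds for some rate function $\beta$ (equivalently, the $F$-Sobolev inequality holds for some $F$; equivalently, the Nash-type inequality holds for some $\theta$) if and only if $$\lim_{n\to\infty}\sup_{|x|>n}\left\{(|x|-n)^{\alpha-1}\mu\big((-|x|,|x|)^c\big)\right\}=0.$$
   Context: The Dirichlet form of $Y$ is $$\mathscr{E}(f,g)=\frac12\int_{\mathbb{R}}\int_{\mathbb{R}}(f(x)-f(y))(g(x)-g(y))\frac{C_\alpha\,\mathrm{d}x\,\mathrm{d}y}{|x-y|^{1+\alpha}},\qquad \mathscr{F}=\{f\in L^2(\mu):\mathscr{E}(f,f)<\infty\},$$ with $C_\alpha=\frac{\alpha2^{\alpha-1}\Gamma((\alpha+1)/2)}{\pi^{1/2}\Gamma(1-\alpha/2)}$; $\mu(f)=\int f\,\mathrm{d}\mu$ and $A^c=\mathbb{R}\setminus A$. Super-Poincaré inequality (with rate function $\beta$): $\beta:(0,\infty)\to(0,\infty)$ is non-increasing and $\mu(f^2)\leqslant r\,\mathscr{E}(f,f)+\beta(r)\,\mu(|f|)^2$ for all $f\in\mathscr{F}$ and all $r>0$. $F$-Sobolev inequality: $F\in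 C(0,\infty)$ is increasing with $\sup_{r\in(0,1]}|rF(r)|<\infty$ and $\lim_{r\to\infty}F(r)=\infty$, and there are constants $C_1>0$, $C_2\geqslant0$ such that $\mu(f^2F(f^2))\leqslant C_1\mathscr{E}(f,f)+C_2$ for all $f\in\mathscr{F}$ with $\mu(f^2)=1$ (with the convention that the integrand is $0$ where $f=0$). Nash-type inequality: $\theta$ is an increasing positive function on $[0,\infty)$ with $\theta(r)/r\to0$ as $r\to\infty$, and $\mu(f^2)\leqslant\theta(\mathscr{E}(f,f))$ for all $f\in\mathscr{F}$ with $\mu(|f|)=1$. *)

theory Defs
  imports "HOL-Analysis.Analysis"
begin

definition speed_measure :: "(real \<Rightarrow> real) \<Rightarrow> real measure" where
  "speed_measure a = density lborel (\<lambda>x. ennreal (1 / a x))"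

definition stable_const :: "real \<Rightarrow> real" where
  "stable_const \<alpha> =
     \<alpha> * 2 powr (\<alpha> - 1) * Gamma ((\<alpha> + 1) / 2) / (sqrt pi * Gamma (1 - \<alpha> / 2))"

(* On the (null) diagonal x = y the numerator vanishes and division by 0 gives 0. *)
definition form_integrand :: "real \<Rightarrow> (real \<Rightarrow> real) \<Rightarrow> (real \<Rightarrow> real) \<Rightarrow> real \<times> real \<Rightarrow> real" where
  "form_integrand \<alpha> f g =
     (\<lambda>(x, y). (f x - f y) * (g x - g y) * (stable_const \<alpha> / \<bar>x - y\<bar> powr (1 + \<alpha>)))"

definition dirichlet_form :: "real \<Rightarrow> (real \<Rightarrow> real) \<Rightarrow> (real \<Rightarrow> real) \<Rightarrow> real" where
  "dirichlet_form \<alpha> f g = 1 / 2 * (\<integral>z. form_integrand \<alpha> f g z \<partial>(lborel \<Otimes>\<^sub>M lborel))"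

(* The Bochner integral of a non-integrable function is 0, so finiteness of the energy
   E(f,f) is expressed as integrability of its (nonnegative) integrand. Elements are functions
   rather than equivalence classes; for a > 0 the speed measure and Lebesgue measure have the
   same null sets, so every notion below is invariant under a.e. modification. *)
definition form_domain :: "real \<Rightarrow> real measure \<Rightarrow> (real \<Rightarrow> real) set" where
  "form_domain \<alpha> \<mu> =
     {f \<in> borel_measurable \<mu>. integrable \<mu> (\<lambda>x. (f x)\<^sup>2) \<and>
        integrable (lborel \<Otimes>\<^sub>M lborel) (form_integrand \<alpha> f f)}"

definition super_Poincare :: "real \<Rightarrow> real measure \<Rightarrow> (real \<Rightarrow> real) \<Rightarrow> bool" where
  "super_Poincare \<alpha> \<mu> \<beta> \<longleftrightarrow>
     (\<forall>r>0. \<beta> r > 0) \<and> antimono_on {0<..} \<beta> \<and>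
     (\<forall>f\<in>form_domain \<alpha> \<mu>. \<forall>r>0.
        (\<integral>x. (f x)\<^sup>2 \<partial>\<mu>) \<le> r * dirichlet_form \<alpha> f f + \<beta> r * (\<integral>x. \<bar>f x\<bar> \<partial>\<mu>)\<^sup>2)"

(* Only the values of F on (0,\<infinity>) matter: where f x = 0 the integrand is 0 * F 0 = 0.
   The bound on r F(r) over (0,1] and monotonicity make the negative part of the integrand
   integrable for a finite \<mu> and f in L^2(\<mu>), so its integral always exists in (-\<infinity>,\<infinity>];
   integrability says that it is finite, which the inequality implicitly asserts. *)
definition F_Sobolev :: "real \<Rightarrow> real measure \<Rightarrow> (real \<Rightarrow> real) \<Rightarrow> bool" where
  "F_Sobolev \<alpha> \<mu> F \<longleftrightarrow>
     continuous_on {0<..} F \<and> mono_on {0<..} F \<and>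
     bdd_above ((\<lambda>r. \<bar>r * F r\<bar>) ` {0<..1}) \<and> filterlim F at_top at_top \<and>
     (\<exists>C1>0. \<exists>C2\<ge>0. \<forall>f\<in>form_domain \<alpha> \<mu>. (\<integral>x. (f x)\<^sup>2 \<partial>\<mu>) = 1 \<longrightarrow>
        integrable \<mu> (\<lambda>x. (f x)\<^sup>2 * F ((f x)\<^sup>2)) \<and>
        (\<integral>x. (f x)\<^sup>2 * F ((f x)\<^sup>2) \<partial>\<mu>) \<le> C1 * dirichlet_form \<alpha> f f + C2)"

definition Nash_type :: "real \<Rightarrow> real measure \<Rightarrow> (real \<Rightarrow> real) \<Rightarrow> bool" where
  "Nash_type \<alpha> \<mu> \<theta> \<longleftrightarrow>
     (\<forall>r\<ge>0. \<theta> r > 0) \<and> mono_on {0..} \<theta> \<and> ((\<lambda>r. \<theta> r / r) \<longlongrightarrow> 0) at_top \<and>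
     (\<forall>f\<in>form_domain \<alpha> \<mu>. (\<integral>x. \<bar>f x\<bar> \<partial>\<mu>) = 1 \<longrightarrow>
        (\<integral>x. (f x)\<^sup>2 \<partial>\<mu>) \<le> \<theta> (dirichlet_form \<alpha> f f))"

(* The supremum may be infinite, hence the values in ennreal. *)
definition tail_condition :: "real \<Rightarrow> real measure \<Rightarrow> bool" where
  "tail_condition \<alpha> \<mu> \<longleftrightarrow>
     (\<lambda>n::nat. SUP x\<in>{x. \<bar>x\<bar> > real n}.
        ennreal ((\<bar>x\<bar> - real n) powr (\<alpha> - 1)) * emeasure \<mu> (- {-\<bar>x\<bar><..<\<bar>x\<bar>}))
     \<longlonglongrightarrow> 0"

end

(* All three inequalities are equivalent to the super-Poincare inequality with an arbitrary constant
   for every r, the weak form below. Since \<alpha> > 1, a function of finite energy is Hoelder continuous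
   of exponent (\<alpha> - 1) / 2 outside a null set, by comparing its means over nested halving intervals.

   Tail condition implies weak form: if f vanishes on [-n, n], the Hoelder estimate bounds the distance
   of each level set of f from [-n, n] from below, so the tail condition bounds its mass by the energy of
   a slice of f. Summing over the dyadic slices gives a Hardy inequality with a small constant. A general f
   is reduced to this case by subtracting a bound of |f| over [-n, n]; comparing |f x| with the mean of |f|
   over a short interval at x gives such a bound with an arbitrarily small multiple of the energy.

   Weak form implies tail condition: test with a ramp of width L, whose energy is of order L^(1 - \<alpha>).

   For the F-Sobolev inequality, choose levels t_j above which normalized f satisfy
   mu((|f| - t_j)^+ ^2) <= 2^-j E(f, f), and let F(s) = sum_j ((1 - t_j / sqrt s)^+)^2. *)
theory Submission
  imports Defs
begin

text \<open>Elements of \<open>form_domain\<close> are functions, so pointwise estimates need an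
  exceptional null set, and one set must serve all slices, truncations and excesses of
  \<open>f\<close>. The set where \<open>jump_energy\<close> is infinite does so: it is explicit,
  null when the energy is finite, and can only shrink under a contraction. Off it, means over
  shrinking intervals converge to the value of the function at a rate that depends on the point; the
  Hoelder constant comes only from the telescoped differences of means, which the total energy
  controls. The two directions match by scaling: an oscillation of size t over a distance d costs
  energy at least of order t^2 d^(1 - \<alpha>), and ramps attain this order. So (|x| - n)^(\<alpha>
  - 1) in the tail condition is, up to constants, the inverse of the least energy for rising from 0
  on [-n, n] to 1 at |x|. The level set estimate obtained from this is only of weak type: with the
  full energy of \<open>f\<close> at every level, the bounds would not be summable. The energy takes
  values in \<open>ennreal\<close>, without \<open>stable_const\<close> and the factor 1 / 2, so
  that Fubini and summation need no integrability conditions.\<close>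

definition jump_energy :: "real \<Rightarrow> (real \<Rightarrow> real) \<Rightarrow> real \<Rightarrow> ennreal" where
  "jump_energy \<alpha> f x = (\<integral>\<^sup>+y. ennreal ((f x - f y)\<^sup>2 / \<bar>x - y\<bar> powr (1 + \<alpha>)) \<partial>lborel)"

definition energy :: "real \<Rightarrow> (real \<Rightarrow> real) \<Rightarrow> ennreal" where
  "energy \<alpha> f = (\<integral>\<^sup>+x. jump_energy \<alpha> f x \<partial>lborel)"

lemma jump_energy_mono:
  assumes "\<And>x y. \<bar>g x - g y\<bar> \<le> \<bar>f x - f y\<bar>"
  shows "jump_energy \<alpha> g x \<le> jump_energy \<alpha> f x"
  unfolding jump_energy_def
  by (intro nn_integral_mono ennreal_leI divide_right_mono) (use assms in \<open>auto simp: abs_le_square_iff\<close>)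

lemma energy_mono:
  assumes "\<And>x y. \<bar>g x - g y\<bar> \<le> \<bar>f x - f y\<bar>"
  shows "energy \<alpha> g \<le> energy \<alpha> f"
  unfolding energy_def by (intro nn_integral_mono jump_energy_mono assms)

lemma measurable_jump_energy [measurable]:
  assumes [measurable]: "f \<in> borel_measurable borel"
  shows "jump_energy \<alpha> f \<in> borel_measurable borel"
  unfolding jump_energy_def by measurable

lemma AE_jump_energy_finite:
  assumes "f \<in> borel_measurable borel" "energy \<alpha> f < \<infinity>"
  shows "AE x in lborel. jump_energy \<alpha> f x < \<infinity>"
proof -
  have "AE x in lborel. jump_energy \<alpha> f x \<noteq> \<infinity>"
    by (rule nn_integral_PInf_AE) (use assms in \<open>auto simp: energy_def\<close>)
  then show ?thesis by (auto simp: top.not_eq_extremum)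
qed

section \<open>Interval means and Hoelder continuity\<close>

definition interval_mean :: "(real \<Rightarrow> real) \<Rightarrow> real \<Rightarrow> real \<Rightarrow> real" where
  "interval_mean f p q = (LINT x:{p..q}|lborel. f x) / (q - p)"

text \<open>Jensen for the square: the convex function t -> (t - c)^2 lies above its tangent at the
  mean, which is \<open>2 * (?m - c) * t - (?m\<^sup>2 - c\<^sup>2)\<close>, and the integral of
  this tangent over the interval is the left-hand side. The bound \<open>N\<close> provides
  integrability.\<close>

lemma interval_mean_Jensen:
  fixes f :: "real \<Rightarrow> real"
  assumes [measurable]: "f \<in> borel_measurable borel" and "\<And>x. \<bar>f x\<bar> \<le> N" and "p < q"
  shows "ennreal ((interval_mean f p q - c)\<^sup>2 * (q - p))
         \<le> (\<integral>\<^sup>+x\<in>{p..q}. ennreal ((f x - c)\<^sup>2) \<partial>lborel)"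
proof -
  let ?m = "interval_mean f p q"
  have N: "\<bar>f x - d\<bar> \<le> N + \<bar>d\<bar>" for x d using assms(2)[of x] by linarith
  have int: "set_integrable lborel {p..q} f"
    unfolding set_integrable_def
    by (rule integrableI_bounded_set_indicator[where B=N]) (use assms in \<open>auto\<close>)
  have int2: "set_integrable lborel {p..q} (\<lambda>x. (f x - c)\<^sup>2)"
    unfolding set_integrable_def
    by (rule integrableI_bounded_set_indicator[where B="(N + \<bar>c\<bar>)\<^sup>2"])
       (use N \<open>p < q\<close> in \<open>auto intro!: AE_I2 simp: abs_le_square_iff[symmetric] intro: order_trans[OF N]\<close>)
  have intc: "set_integrable lborel {p..q} (\<lambda>x. d)" for d :: real
    unfolding set_integrable_def
    by (rule integrableI_bounded_set_indicator[where B="\<bar>d\<bar>"]) (use \<open>p < q\<close> in auto)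
  have Lc: "(LINT x:{p..q}|lborel. d) = d * (q - p)" for d :: real
    using \<open>p < q\<close> by (simp add: set_lebesgue_integral_def)
  have "(?m - c)\<^sup>2 * (q - p) = (LINT x:{p..q}|lborel. (?m - c)\<^sup>2)"
    using Lc by simp
  have Lf: "(LINT x:{p..q}|lborel. f x) = ?m * (q - p)"
    using \<open>p < q\<close> by (simp add: interval_mean_def)
  have "(LINT x:{p..q}|lborel. 2 * (?m - c) * f x - (?m\<^sup>2 - c\<^sup>2))
      = 2 * (?m - c) * (LINT x:{p..q}|lborel. f x) - (LINT x:{p..q}|lborel. ?m\<^sup>2 - c\<^sup>2)"
    by (subst set_integral_diff) (auto intro!: set_integrable_mult_right int intc)
  also have "\<dots> = (?m - c)\<^sup>2 * (q - p)"
    by (simp only: Lf Lc) (simp add: power2_eq_square algebra_simps)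
  finally have "(?m - c)\<^sup>2 * (q - p) = (LINT x:{p..q}|lborel. 2 * (?m - c) * f x - (?m\<^sup>2 - c\<^sup>2))" ..
  also have "\<dots> \<le> (LINT x:{p..q}|lborel. (f x - c)\<^sup>2)"
  proof (rule set_integral_mono)
    show "set_integrable lborel {p..q} (\<lambda>x. 2 * (?m - c) * f x - (?m\<^sup>2 - c\<^sup>2))"
      by (intro set_integral_diff set_integrable_mult_right int intc)
    show "2 * (?m - c) * f x - (?m\<^sup>2 - c\<^sup>2) \<le> (f x - c)\<^sup>2" for x
      using zero_le_power2[of "f x - ?m"] by (simp add: power2_eq_square algebra_simps)
  qed (rule int2)
  finally have "ennreal ((?m - c)\<^sup>2 * (q - p)) \<le> ennreal (LINT x:{p..q}|lborel. (f x - c)\<^sup>2)"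
    by (rule ennreal_leI)
  also have "\<dots> = (\<integral>\<^sup>+x\<in>{p..q}. ennreal ((f x - c)\<^sup>2) \<partial>lborel)"
    using int2 unfolding set_lebesgue_integral_def set_integrable_def
    by (subst nn_integral_eq_integral[symmetric])
       (auto intro!: nn_integral_cong simp: indicator_def)
  finally show ?thesis .
qed

text \<open>Two points of [p, q] are at distance at most q - p, so the kernel is at least (q -
  p)^(-1 - \<alpha>) there. The separate set \<open>J\<close> allows an integration over a smaller
  interval than the one that contains \<open>u\<close>.\<close>

lemma interval_nn_integral_le_jump_energy:
  assumes "u \<in> {p..q}" "J \<subseteq> {p..q}" "\<alpha> > 0" and [measurable]: "J \<in> sets borel" "f \<in> borel_measurable borel"
  shows "(\<integral>\<^sup>+v\<in>J. ennreal ((f v - f u)\<^sup>2) \<partial>lborel) \<le> ennreal ((q - p) powr (1 + \<alpha>)) * jump_energy \<alpha> f u"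
proof -
  have "(\<integral>\<^sup>+v\<in>J. ennreal ((f v - f u)\<^sup>2) \<partial>lborel)
     \<le> (\<integral>\<^sup>+v. ennreal ((q - p) powr (1 + \<alpha>)) * ennreal ((f u - f v)\<^sup>2 / \<bar>u - v\<bar> powr (1 + \<alpha>)) \<partial>lborel)"
  proof (rule nn_integral_mono)
    fix v :: real
    show "ennreal ((f v - f u)\<^sup>2) * indicator J v
      \<le> ennreal ((q - p) powr (1 + \<alpha>)) * ennreal ((f u - f v)\<^sup>2 / \<bar>u - v\<bar> powr (1 + \<alpha>))"
    \<comment> \<open>The point \<open>v = u\<close> is set apart because the quotient is 0 there by
      convention; the left-hand side vanishes as well.\<close>
    proof (cases "v \<in> J \<and> u \<noteq> v")
      case True
      then have "v \<in> {p..q}" using assms(2) by blast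
      then have "\<bar>u - v\<bar> \<le> q - p" using assms(1) by (simp add: abs_le_iff)
      then have "\<bar>u - v\<bar> powr (1 + \<alpha>) \<le> (q - p) powr (1 + \<alpha>)"
        using assms(3) by (intro powr_mono2) auto
      then have "(f v - f u)\<^sup>2 * \<bar>u - v\<bar> powr (1 + \<alpha>) \<le> (f v - f u)\<^sup>2 * (q - p) powr (1 + \<alpha>)"
        by (intro mult_left_mono) auto
      then have "(f v - f u)\<^sup>2 \<le> (q - p) powr (1 + \<alpha>) * ((f u - f v)\<^sup>2 / \<bar>u - v\<bar> powr (1 + \<alpha>))"
        using True by (simp add: field_simps power2_commute)
      then show ?thesis using True by (simp flip: ennreal_mult')
    qed auto
  qed
  also have "\<dots> = ennreal ((q - p) powr (1 + \<alpha>)) * jump_energy \<alpha> f u"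
    unfolding jump_energy_def by (rule nn_integral_cmult) measurable
  finally show ?thesis .
qed

text \<open>Jensen with \<open>c = f x\<close>, followed by the kernel bound. The estimate depends
  on the point through \<open>Q\<close>, so it yields convergence of the means to \<open>f x\<close>
  but no uniform modulus.\<close>

lemma interval_mean_minus_point:
  assumes "f \<in> borel_measurable borel" "\<And>x. \<bar>f x\<bar> \<le> N" "x \<in> {p..q}" "p < q" "\<alpha> > 0"
    and "jump_energy \<alpha> f x \<le> ennreal Q" "Q \<ge> 0"
  shows "(interval_mean f p q - f x)\<^sup>2 \<le> (q - p) powr \<alpha> * Q"
proof -
  have "ennreal ((interval_mean f p q - f x)\<^sup>2 * (q - p))
       \<le> ennreal ((q - p) powr (1 + \<alpha>)) * jump_energy \<alpha> f x"
    by (rule order_trans[OF interval_mean_Jensen interval_nn_integral_le_jump_energy]) (use assms in auto)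
  also have "\<dots> \<le> ennreal ((q - p) powr (1 + \<alpha>)) * ennreal Q"
    by (intro mult_left_mono assms) simp
  also have "\<dots> = ennreal ((q - p) powr (1 + \<alpha>) * Q)" using assms by (simp add: ennreal_mult)
  finally have "(interval_mean f p q - f x)\<^sup>2 * (q - p) \<le> (q - p) powr (1 + \<alpha>) * Q"
    using assms by (simp add: ennreal_le_iff)
  also have "\<dots> = (q - p) powr \<alpha> * Q * (q - p)"
    using assms by (simp add: powr_add)
  finally show ?thesis using assms by simp
qed

text \<open>Jensen twice: over the outer interval around the inner mean, then over the inner
  interval around \<open>f u\<close>. What remains is a double integral of (f u - f v)^2 over the
  product of the intervals, which the kernel bound compares with the energy.\<close>

lemma interval_mean_diff:
  assumes [measurable]: "f \<in> borel_measurable borel" and "\<And>x. \<bar>f x\<bar> \<le> N" "p \<le> p'" "q' \<le> q" "p' < q'" "\<alpha> > 0"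
    and "energy \<alpha> f \<le> ennreal E" "E \<ge> 0"
  shows "(interval_mean f p q - interval_mean f p' q')\<^sup>2 \<le> (q - p) powr \<alpha> / (q' - p') * E"
proof -
  let ?A = "interval_mean f p q" and ?B = "interval_mean f p' q'"
  have "ennreal ((?A - ?B)\<^sup>2 * (q - p)) * ennreal (q' - p')
     \<le> (\<integral>\<^sup>+u\<in>{p..q}. ennreal ((f u - ?B)\<^sup>2) \<partial>lborel) * ennreal (q' - p')"
    by (intro mult_right_mono interval_mean_Jensen[where N=N]) (use assms in auto)
  also have "\<dots> = (\<integral>\<^sup>+u\<in>{p..q}. ennreal ((?B - f u)\<^sup>2 * (q' - p')) \<partial>lborel)"
    using assms by (subst nn_integral_multc[symmetric])
       (auto intro!: nn_integral_cong simp: ennreal_mult power2_commute mult_ac)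
  also have "\<dots> \<le> (\<integral>\<^sup>+u. ennreal ((q - p) powr (1 + \<alpha>)) * jump_energy \<alpha> f u \<partial>lborel)"
  proof (rule nn_integral_mono)
    fix u
    show "ennreal ((?B - f u)\<^sup>2 * (q' - p')) * indicator {p..q} u
       \<le> ennreal ((q - p) powr (1 + \<alpha>)) * jump_energy \<alpha> f u"
    proof (cases "u \<in> {p..q}")
      case True
      have "ennreal ((?B - f u)\<^sup>2 * (q' - p')) \<le> ennreal ((q - p) powr (1 + \<alpha>)) * jump_energy \<alpha> f u"
        by (rule order_trans[OF interval_mean_Jensen interval_nn_integral_le_jump_energy])
           (use assms True in auto)
      then show ?thesis using True by simp
    qed simp
  qed
  also have "\<dots> = ennreal ((q - p) powr (1 + \<alpha>)) * energy \<alpha> f"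
    unfolding energy_def by (rule nn_integral_cmult) measurable
  also have "\<dots> \<le> ennreal ((q - p) powr (1 + \<alpha>)) * ennreal E"
    by (intro mult_left_mono assms) simp
  also have "\<dots> = ennreal ((q - p) powr (1 + \<alpha>) * E)" using assms by (simp add: ennreal_mult)
  also have "ennreal ((?A - ?B)\<^sup>2 * (q - p)) * ennreal (q' - p') = ennreal ((?A - ?B)\<^sup>2 * (q - p) * (q' - p'))"
    using assms by (simp add: ennreal_mult)
  finally have "(?A - ?B)\<^sup>2 * (q - p) * (q' - p') \<le> (q - p) powr (1 + \<alpha>) * E"
    using assms by (simp add: ennreal_le_iff)
  also have "(q - p) powr (1 + \<alpha>) = (q - p) * (q - p) powr \<alpha>"
    using assms by (simp add: powr_add)
  finally have "(?A - ?B)\<^sup>2 * (q' - p') \<le> (q - p) powr \<alpha> * E"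
    using assms by (simp add: mult_ac)
  then show ?thesis using assms by (simp add: field_simps)
qed

text \<open>Increments of means are of order (length)^((\<alpha> - 1) / 2); this is the factor
  gained when the length is halved. It is below 1 because \<alpha> > 1.\<close>

definition halving_ratio :: "real \<Rightarrow> real" where
  "halving_ratio \<alpha> = 2 powr (- (\<alpha> - 1) / 2)"

lemma halving_ratio: "1 < \<alpha> \<Longrightarrow> 0 < halving_ratio \<alpha>" "1 < \<alpha> \<Longrightarrow> halving_ratio \<alpha> < 1"
  unfolding halving_ratio_def by (auto intro: powr_less_one)

text \<open>The increments of the means along the nested intervals are dominated by a geometric
  series, and the means converge to \<open>f x\<close>. The intervals are kept general so that they
  may shrink towards either endpoint of the first one.\<close>

lemma halving_interval_mean_minus_point:
  assumes [measurable]: "f \<in> borel_measurable borel" and "\<And>x. \<bar>f x\<bar> \<le> N" "1 < \<alpha>" "L > 0"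
    and "energy \<alpha> f \<le> ennreal E" "E \<ge> 0" "jump_energy \<alpha> f x < \<infinity>"
    and len: "\<And>k. q k - p k = L / 2 ^ k" and x: "\<And>k. p k \<le> x" "\<And>k. x \<le> q k"
    and nest: "\<And>k. p k \<le> p (Suc k)" "\<And>k. q (Suc k) \<le> q k"
  shows "\<bar>interval_mean f (p 0) (q 0) - f x\<bar> \<le> sqrt (2 * L powr (\<alpha> - 1) * E) / (1 - halving_ratio \<alpha>)"
proof -
  let ?\<rho> = "halving_ratio \<alpha>" and ?S = "sqrt (2 * L powr (\<alpha> - 1) * E)"
  define A where "A k = interval_mean f (p k) (q k)" for k
  note rho = halving_ratio[OF assms(3)]
  have pq: "p k < q k" for k using len[of k] \<open>L > 0\<close> by (metis diff_gt_0_iff_gt divide_pos_pos zero_less_numeral zero_less_power)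
  have rhok: "?\<rho> ^ k = sqrt ((1 / 2 ^ k) powr (\<alpha> - 1))" for k
  proof -
    have "(1 / 2 ^ k :: real) = 2 powr (- real k)"
      by (simp add: powr_minus powr_realpow field_simps)
    then have "sqrt ((1 / 2 ^ k) powr (\<alpha> - 1)) = 2 powr (- real k * (\<alpha> - 1) * (1 / 2))"
      by (simp add: powr_half_sqrt[symmetric] powr_powr)
    also have "- real k * (\<alpha> - 1) * (1 / 2) = (- (\<alpha> - 1) / 2) * real k" by (simp add: algebra_simps)
    also have "2 powr \<dots> = ?\<rho> ^ k"
      by (simp only: powr_powr[symmetric] halving_ratio_def) (simp add: powr_realpow)
    finally show ?thesis ..
  qed
  have step: "\<bar>A k - A (Suc k)\<bar> \<le> ?S * ?\<rho> ^ k" for k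
  proof -
    have "(A k - A (Suc k))\<^sup>2 \<le> (q k - p k) powr \<alpha> / (q (Suc k) - p (Suc k)) * E"
      unfolding A_def by (rule interval_mean_diff) (use assms pq in auto)
    \<comment> \<open>The factor 2 arises because the inner interval has half the length of the
      outer one.\<close>
    also have "(q k - p k) powr \<alpha> / (q (Suc k) - p (Suc k)) = 2 * (L / 2 ^ k) powr (\<alpha> - 1)"
      using \<open>L > 0\<close> by (simp add: len powr_diff field_simps)
    also have "\<dots> * E = 2 * L powr (\<alpha> - 1) * E * (1 / 2 ^ k) powr (\<alpha> - 1)"
      using \<open>L > 0\<close> by (simp add: powr_divide field_simps)
    finally have "sqrt ((A k - A (Suc k))\<^sup>2) \<le> sqrt (2 * L powr (\<alpha> - 1) * E * (1 / 2 ^ k) powr (\<alpha> - 1))"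
      by (rule real_sqrt_le_mono)
    then show ?thesis by (simp add: rhok flip: real_sqrt_mult)
  qed
  have tele: "\<bar>A 0 - A k\<bar> \<le> ?S / (1 - ?\<rho>)" for k
  proof -
    have "\<bar>A 0 - A k\<bar> \<le> (\<Sum>i<k. \<bar>A i - A (Suc i)\<bar>)"
      by (induction k) auto
    also have "\<dots> \<le> (\<Sum>i<k. ?S * ?\<rho> ^ i)" by (intro sum_mono step)
    also have "\<dots> = ?S * (\<Sum>i<k. ?\<rho> ^ i)" by (simp add: sum_distrib_left)
    also have "\<dots> \<le> ?S * (1 / (1 - ?\<rho>))"
    proof (rule mult_left_mono)
      show "(\<Sum>i<k. ?\<rho> ^ i) \<le> 1 / (1 - ?\<rho>)"
        using rho by (subst sum_gp_strict) (auto intro!: divide_right_mono)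
    qed (use assms in auto)
    finally show ?thesis by simp
  qed
  \<comment> \<open>Finiteness of \<open>jump_energy\<close> at \<open>x\<close> enters only here;
    its value \<open>Q\<close> disappears in the limit.\<close>
  have lim: "A \<longlonglongrightarrow> f x"
  proof -
    obtain Q where Q: "jump_energy \<alpha> f x = ennreal Q" "Q \<ge> 0"
      using assms(7) by (cases "jump_energy \<alpha> f x") auto
    have "(A k - f x)\<^sup>2 \<le> (L / 2 ^ k) powr \<alpha> * Q" for k
      unfolding A_def using interval_mean_minus_point[of f N x "p k" "q k" \<alpha> Q] assms pq Q by (auto simp: len)
    then have b: "\<bar>A k - f x\<bar> \<le> sqrt ((L / 2 ^ k) powr \<alpha> * Q)" for k
      by (simp add: real_le_rsqrt)
    have "(\<lambda>k. L * (1/2) ^ k) \<longlonglongrightarrow> L * 0"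
      by (intro tendsto_mult_left LIMSEQ_power_zero) auto
    then have "(\<lambda>k. L / 2 ^ k) \<longlonglongrightarrow> 0" by (simp add: power_divide)
    then have "(\<lambda>k. (L / 2 ^ k) powr \<alpha>) \<longlonglongrightarrow> 0 powr \<alpha>"
      by (rule tendsto_powr') (use assms in \<open>auto intro!: always_eventually\<close>)
    then have "(\<lambda>k. sqrt ((L / 2 ^ k) powr \<alpha> * Q)) \<longlonglongrightarrow> sqrt (0 powr \<alpha> * Q)"
      by (intro tendsto_real_sqrt tendsto_mult_right)
    then have "(\<lambda>k. \<bar>A k - f x\<bar>) \<longlonglongrightarrow> 0"
      by (intro tendsto_sandwich[OF _ _ tendsto_const, of 0 "\<lambda>k. \<bar>A k - f x\<bar>" _ "\<lambda>k. sqrt ((L / 2 ^ k) powr \<alpha> * Q)"])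
         (use b in \<open>auto intro!: always_eventually\<close>)
    then show ?thesis by (simp add: LIM_zero_iff tendsto_rabs_zero_iff)
  qed
  have "(\<lambda>k. \<bar>A 0 - A k\<bar>) \<longlonglongrightarrow> \<bar>A 0 - f x\<bar>"
    by (intro tendsto_intros lim)
  then have "\<bar>A 0 - f x\<bar> \<le> ?S / (1 - ?\<rho>)"
    by (rule LIMSEQ_le_const2) (use tele in auto)
  then show ?thesis by (simp add: A_def)
qed

text \<open>Each endpoint differs from the common mean by at most sqrt (2 L^(\<alpha> - 1) E) / (1 -
  ratio); the square of twice this bound gives 8 = 4 * 2.\<close>

definition hoelder_const :: "real \<Rightarrow> real" where
  "hoelder_const \<alpha> = 8 / (1 - halving_ratio \<alpha>)\<^sup>2"

lemma hoelder_const_pos: "1 < \<alpha> \<Longrightarrow> hoelder_const \<alpha> > 0"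
  using halving_ratio[of \<alpha>] by (simp add: hoelder_const_def)

text \<open>Two halving sequences start from the same interval [x, y], one shrinking to
  \<open>x\<close> and the other to \<open>y\<close>; the common initial mean links the two
  values.\<close>

lemma hoelder_bounded:
  assumes [measurable]: "f \<in> borel_measurable borel" and "\<And>x. \<bar>f x\<bar> \<le> N" "1 < \<alpha>" "x < y"
    and "energy \<alpha> f \<le> ennreal E" "E \<ge> 0" "jump_energy \<alpha> f x < \<infinity>" "jump_energy \<alpha> f y < \<infinity>"
  shows "(f x - f y)\<^sup>2 \<le> hoelder_const \<alpha> * (y - x) powr (\<alpha> - 1) * E"
proof -
  let ?L = "y - x"
  let ?T = "sqrt (2 * ?L powr (\<alpha> - 1) * E) / (1 - halving_ratio \<alpha>)"
  have mono: "?L / (2 * 2 ^ k) \<le> ?L / 2 ^ k" for k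
    using \<open>x < y\<close> by (intro divide_left_mono) auto
  have "\<bar>interval_mean f x (x + ?L / 2 ^ 0) - f x\<bar> \<le> ?T"
    by (rule halving_interval_mean_minus_point[where p="\<lambda>k. x" and q="\<lambda>k. x + ?L / 2 ^ k" and N=N])
       (use assms mono in auto)
  moreover have "\<bar>interval_mean f (y - ?L / 2 ^ 0) y - f y\<bar> \<le> ?T"
    by (rule halving_interval_mean_minus_point[where p="\<lambda>k. y - ?L / 2 ^ k" and q="\<lambda>k. y" and N=N])
       (use assms mono in auto)
  ultimately have "\<bar>f x - f y\<bar> \<le> 2 * ?T" by simp
  then have "(f x - f y)\<^sup>2 \<le> (2 * ?T)\<^sup>2"
    by (metis abs_ge_zero power2_abs power_mono)
  also have "\<dots> = hoelder_const \<alpha> * (y - x) powr (\<alpha> - 1) * E"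
    using assms by (simp add: hoelder_const_def power_mult_distrib power_divide)
  finally show ?thesis .
qed

text \<open>Clamping at a level above both values leaves them unchanged and does not increase the energy,
  so boundedness is not needed.\<close>
lemma hoelder:
  assumes [measurable]: "f \<in> borel_measurable borel" and "1 < \<alpha>"
    and "energy \<alpha> f \<le> ennreal E" "E \<ge> 0" "jump_energy \<alpha> f x < \<infinity>" "jump_energy \<alpha> f y < \<infinity>"
  shows "(f x - f y)\<^sup>2 \<le> hoelder_const \<alpha> * \<bar>x - y\<bar> powr (\<alpha> - 1) * E"
proof -
  define N where "N = max \<bar>f x\<bar> \<bar>f y\<bar>"
  define g where "g z = max (-N) (min N (f z))" for z
  have N: "N \<ge> 0" by (auto simp: N_def)
  have [measurable]: "g \<in> borel_measurable borel" unfolding g_def by measurable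
  have le: "\<bar>g u - g v\<bar> \<le> \<bar>f u - f v\<bar>" for u v unfolding g_def using N by linarith
  have gN: "\<bar>g z\<bar> \<le> N" for z unfolding g_def using N by linarith
  have g: "g x = f x" "g y = f y" unfolding g_def N_def by linarith+
  have e: "energy \<alpha> g \<le> ennreal E" using energy_mono[of g f, OF le] assms(3) by (rule order_trans)
  have j: "jump_energy \<alpha> g x < \<infinity>" "jump_energy \<alpha> g y < \<infinity>"
    using jump_energy_mono[of g f \<alpha>, OF le] assms(5,6) by (auto intro: le_less_trans)
  show ?thesis
  proof (cases x y rule: linorder_cases)
    case less
    then show ?thesis using hoelder_bounded[of g N \<alpha> x y E] gN e j assms by (auto simp: g)
  next
    case equal
    then show ?thesis by simp
  next
    case greater
    then show ?thesis using hoelder_bounded[of g N \<alpha> y x E] gN e j assms by (auto simp: g power2_commute)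
  qed
qed

section \<open>The Dirichlet form expressed by the energy, and the speed measure\<close>

lemma stable_const_pos:
  assumes "0 < \<alpha>" "\<alpha> < 2"
  shows "stable_const \<alpha> > 0"
  unfolding stable_const_def using assms by (intro divide_pos_pos mult_pos_pos Gamma_real_pos) auto

lemma energy_eq_nn_integral_pair:
  assumes [measurable]: "f \<in> borel_measurable borel"
  shows "energy \<alpha> f
    = (\<integral>\<^sup>+(x, y). ennreal ((f x - f y)\<^sup>2 / \<bar>x - y\<bar> powr (1 + \<alpha>)) \<partial>(lborel \<Otimes>\<^sub>M lborel))"
  unfolding energy_def jump_energy_def
  by (subst lborel.nn_integral_fst[symmetric]) (simp_all add: case_prod_beta)

lemma nn_integral_form_integrand:
  assumes [measurable]: "f \<in> borel_measurable borel" and "0 < \<alpha>" "\<alpha> < 2"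
  shows "(\<integral>\<^sup>+z. ennreal (form_integrand \<alpha> f f z) \<partial>(lborel \<Otimes>\<^sub>M lborel)) = ennreal (stable_const \<alpha>) * energy \<alpha> f"
proof -
  have "(\<integral>\<^sup>+z. ennreal (form_integrand \<alpha> f f z) \<partial>(lborel \<Otimes>\<^sub>M lborel))
    = (\<integral>\<^sup>+z. ennreal (stable_const \<alpha>) * (case z of (x, y) \<Rightarrow> ennreal ((f x - f y)\<^sup>2 / \<bar>x - y\<bar> powr (1 + \<alpha>)))
        \<partial>(lborel \<Otimes>\<^sub>M lborel))"
    using stable_const_pos[OF assms(2,3)]
    by (intro nn_integral_cong)
       (auto simp: form_integrand_def power2_eq_square mult_ac simp flip: ennreal_mult')
  also have "\<dots> = ennreal (stable_const \<alpha>) * energy \<alpha> f"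
    by (subst nn_integral_cmult) (simp_all add: energy_eq_nn_integral_pair case_prod_beta)
  finally show ?thesis .
qed

lemma measurable_form_integrand [measurable]:
  assumes [measurable]: "f \<in> borel_measurable borel" "g \<in> borel_measurable borel"
  shows "form_integrand \<alpha> f g \<in> borel_measurable (lborel \<Otimes>\<^sub>M lborel)"
  unfolding form_integrand_def by measurable

lemma form_integrand_nonneg:
  assumes "0 < \<alpha>" "\<alpha> < 2"
  shows "form_integrand \<alpha> f f z \<ge> 0"
  using stable_const_pos[OF assms]
  by (cases z) (auto simp: form_integrand_def simp flip: power2_eq_square intro!: mult_nonneg_nonneg)

lemma integrable_form_integrand_iff:
  assumes [measurable]: "f \<in> borel_measurable borel" and "0 < \<alpha>" "\<alpha> < 2"
  shows "integrable (lborel \<Otimes>\<^sub>M lborel) (form_integrand \<alpha> f f) \<longleftrightarrow> energy \<alpha> f < \<infinity>"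
  using stable_const_pos[OF assms(2,3)] form_integrand_nonneg[OF assms(2,3), of f]
  by (auto simp: integrable_iff_bounded nn_integral_form_integrand assms ennreal_mult_less_top)

lemma dirichlet_form_eq_energy:
  assumes [measurable]: "f \<in> borel_measurable borel" and "0 < \<alpha>" "\<alpha> < 2"
  shows "dirichlet_form \<alpha> f f = stable_const \<alpha> / 2 * enn2real (energy \<alpha> f)"
  unfolding dirichlet_form_def using stable_const_pos[OF assms(2,3)] form_integrand_nonneg[OF assms(2,3), of f]
  by (subst integral_eq_nn_integral) (auto simp: nn_integral_form_integrand assms enn2real_mult)

lemma sets_speed_measure [simp, measurable_cong]: "sets (speed_measure a) = sets borel"
  by (simp add: speed_measure_def)

lemma space_speed_measure [simp]: "space (speed_measure a) = UNIV"
  by (simp add: speed_measure_def)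

lemma emeasure_speed_measure:
  assumes [measurable]: "a \<in> borel_measurable borel" "A \<in> sets borel"
  shows "emeasure (speed_measure a) A = (\<integral>\<^sup>+x\<in>A. ennreal (1 / a x) \<partial>lborel)"
  unfolding speed_measure_def by (subst emeasure_density) auto

text \<open>Neither sign nor monotonicity in \<open>r\<close> is asked of \<open>B\<close>, so each
  of the three inequalities can be shown to imply this form for one \<open>r\<close> at a
  time.\<close>

definition weak_super_Poincare :: "real \<Rightarrow> real measure \<Rightarrow> bool" where
  "weak_super_Poincare \<alpha> \<mu> \<longleftrightarrow>
     (\<forall>r>0. \<exists>B. \<forall>f\<in>form_domain \<alpha> \<mu>.
        (\<integral>x. (f x)\<^sup>2 \<partial>\<mu>) \<le> r * dirichlet_form \<alpha> f f + B * (\<integral>x. \<bar>f x\<bar> \<partial>\<mu>)\<^sup>2)"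

section \<open>The form domain and its stability under contractions\<close>

locale time_changed_stable =
  fixes \<alpha> :: real and a :: "real \<Rightarrow> real"
  assumes alpha: "1 < \<alpha>" "\<alpha> < 2"
    and cont_a: "continuous_on UNIV a" and a_pos: "\<And>x. a x > 0"
    and integral_a: "has_bochner_integral lborel (\<lambda>x. 1 / a x) 1"
begin

abbreviation \<mu> :: "real measure" where "\<mu> \<equiv> speed_measure a"

abbreviation \<F> :: "(real \<Rightarrow> real) set" where "\<F> \<equiv> form_domain \<alpha> \<mu>"

abbreviation \<E> :: "(real \<Rightarrow> real) \<Rightarrow> real" where "\<E> f \<equiv> dirichlet_form \<alpha> f f"

lemma measurable_a [measurable]: "a \<in> borel_measurable borel"
  using cont_a by (rule borel_measurable_continuous_onI)

lemma emeasure_UNIV: "emeasure \<mu> UNIV = 1"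
proof -
  have "emeasure \<mu> UNIV = (\<integral>\<^sup>+x. ennreal (1 / a x) \<partial>lborel)"
    by (subst emeasure_speed_measure) auto
  also have "\<dots> = ennreal 1"
    using integral_a a_pos by (subst nn_integral_eq_integral) (auto simp: has_bochner_integral_iff intro: less_imp_le)
  finally show ?thesis by simp
qed

sublocale finite_measure \<mu>
  by standard (simp add: emeasure_UNIV)

lemma measure_UNIV [simp]: "measure \<mu> UNIV = 1"
  by (simp add: measure_def emeasure_UNIV)

lemma AE_speed_measure:
  assumes "AE x in lborel. P x"
  shows "AE x in \<mu>. P x"
  unfolding speed_measure_def by (subst AE_density) (use assms in \<open>auto elim: eventually_mono\<close>)

lemma domain_iff:
  "f \<in> \<F> \<longleftrightarrow> f \<in> borel_measurable borel \<and> integrable \<mu> (\<lambda>x. (f x)\<^sup>2) \<and> energy \<alpha> f < \<infinity>"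
proof (cases "f \<in> borel_measurable borel")
  case True
  then show ?thesis
    using alpha integrable_form_integrand_iff[of f \<alpha>]
    by (simp add: form_domain_def cong: measurable_cong_sets)
next
  case False
  then show ?thesis by (simp add: form_domain_def cong: measurable_cong_sets)
qed

lemma domainD:
  assumes "f \<in> \<F>"
  shows "f \<in> borel_measurable borel" "integrable \<mu> (\<lambda>x. (f x)\<^sup>2)" "energy \<alpha> f < \<infinity>"
  using assms by (auto simp: domain_iff)

lemma domain_abs_integrable:
  assumes "f \<in> \<F>"
  shows "integrable \<mu> f" "integrable \<mu> (\<lambda>x. \<bar>f x\<bar>)"
proof -
  note [measurable] = domainD(1)[OF assms]
  show "integrable \<mu> f"
  proof (rule Bochner_Integration.integrable_bound)
    show "integrable \<mu> (\<lambda>x. 1 + (f x)\<^sup>2)" using domainD[OF assms] by auto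
    have "\<bar>t\<bar> \<le> 1 + t\<^sup>2" for t :: real
      using zero_le_power2[of "\<bar>t\<bar> - 1"] zero_le_power2[of t] by (simp add: power2_diff)
    then show "AE x in \<mu>. norm (f x) \<le> norm (1 + (f x)\<^sup>2)" by (auto intro!: AE_I2 order_trans[OF _ abs_ge_self])
  qed measurable
  then show "integrable \<mu> (\<lambda>x. \<bar>f x\<bar>)" by auto
qed

lemma form_nonneg: "f \<in> borel_measurable borel \<Longrightarrow> \<E> f \<ge> 0"
  using alpha stable_const_pos[of \<alpha>] by (simp add: dirichlet_form_eq_energy)

lemma domain_contraction:
  assumes "f \<in> \<F>" and [measurable]: "g \<in> borel_measurable borel"
    and "\<And>x y. \<bar>g x - g y\<bar> \<le> \<bar>f x - f y\<bar>" "\<And>x. \<bar>g x\<bar> \<le> \<bar>f x\<bar>"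
  shows "g \<in> \<F>" "\<E> g \<le> \<E> f"
proof -
  have le: "energy \<alpha> g \<le> energy \<alpha> f" by (rule energy_mono) (rule assms)
  have "integrable \<mu> (\<lambda>x. (g x)\<^sup>2)"
    by (rule Bochner_Integration.integrable_bound[OF domainD(2)[OF assms(1)]])
       (use assms(4) in \<open>auto simp: abs_le_square_iff\<close>)
  then show "g \<in> \<F>" using le domainD[OF assms(1)] by (auto simp: domain_iff)
  show "\<E> g \<le> \<E> f"
    using alpha stable_const_pos[of \<alpha>] le domainD[OF assms(1)]
    by (auto simp: dirichlet_form_eq_energy intro!: mult_left_mono enn2real_mono)
qed

lemma energy_cmult:
  assumes [measurable]: "f \<in> borel_measurable borel"
  shows "energy \<alpha> (\<lambda>x. c * f x) = ennreal (c\<^sup>2) * energy \<alpha> f"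
proof -
  have eq: "(c * f x - c * f y)\<^sup>2 / \<bar>x - y\<bar> powr (1 + \<alpha>) = c\<^sup>2 * ((f x - f y)\<^sup>2 / \<bar>x - y\<bar> powr (1 + \<alpha>))" for x y
    by (simp only: right_diff_distrib[symmetric] power_mult_distrib times_divide_eq_right)
  have "jump_energy \<alpha> (\<lambda>x. c * f x) x = ennreal (c\<^sup>2) * jump_energy \<alpha> f x" for x
    unfolding jump_energy_def
    by (subst nn_integral_cmult[symmetric]) (measurable, simp only: eq ennreal_mult'[OF zero_le_power2])
  then show ?thesis
    unfolding energy_def by (subst nn_integral_cmult[symmetric]) (auto intro!: nn_integral_cong)
qed

lemma domain_cmult:
  assumes "f \<in> \<F>"
  shows "(\<lambda>x. c * f x) \<in> \<F>" "\<E> (\<lambda>x. c * f x) = c\<^sup>2 * \<E> f"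
proof -
  note [measurable] = domainD(1)[OF assms]
  show "(\<lambda>x. c * f x) \<in> \<F>"
    using domainD[OF assms] by (auto simp: domain_iff energy_cmult power_mult_distrib ennreal_mult_less_top)
  show "\<E> (\<lambda>x. c * f x) = c\<^sup>2 * \<E> f"
    using alpha by (simp add: dirichlet_form_eq_energy energy_cmult enn2real_mult)
qed

lemma domain_excess:
  assumes "f \<in> \<F>" "t \<ge> 0"
  shows "(\<lambda>x. max 0 (\<bar>f x\<bar> - t)) \<in> \<F>" "\<E> (\<lambda>x. max 0 (\<bar>f x\<bar> - t)) \<le> \<E> f"
proof -
  note [measurable] = domainD(1)[OF assms(1)]
  have "\<bar>max 0 (\<bar>u\<bar> - t) - max 0 (\<bar>v\<bar> - t)\<bar> \<le> \<bar>u - v\<bar>" "\<bar>max 0 (\<bar>u\<bar> - t)\<bar> \<le> \<bar>u\<bar>" for u v :: real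
    using assms(2) by linarith+
  then show "(\<lambda>x. max 0 (\<bar>f x\<bar> - t)) \<in> \<F>" "\<E> (\<lambda>x. max 0 (\<bar>f x\<bar> - t)) \<le> \<E> f"
    by (auto intro!: domain_contraction[OF assms(1)])
qed

section \<open>Passing between the three inequalities and the weak form\<close>

lemma L1_norm_zero_imp_L2_zero:
  assumes "f \<in> \<F>" "(\<integral>x. \<bar>f x\<bar> \<partial>\<mu>) = 0"
  shows "(\<integral>x. (f x)\<^sup>2 \<partial>\<mu>) = 0"
proof -
  have "AE x in \<mu>. \<bar>f x\<bar> = 0"
    using integral_nonneg_eq_0_iff_AE[OF domain_abs_integrable(2)[OF assms(1)]] assms(2) by simp
  then show ?thesis by (intro integral_eq_zero_AE) auto
qed

text \<open>The sets \<open>S r\<close> of nonnegative admissible constants are upward closed and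
  grow with \<open>r\<close>, so their infima are nonincreasing. Adding 1 makes the rate positive
  and places it in \<open>S r\<close> without asking whether the infimum is attained.\<close>

lemma super_Poincare_iff_weak:
  "(\<exists>\<beta>. super_Poincare \<alpha> \<mu> \<beta>) \<longleftrightarrow> weak_super_Poincare \<alpha> \<mu>"
proof
  assume "\<exists>\<beta>. super_Poincare \<alpha> \<mu> \<beta>"
  then obtain \<beta> where "super_Poincare \<alpha> \<mu> \<beta>" ..
  then show "weak_super_Poincare \<alpha> \<mu>"
    unfolding super_Poincare_def weak_super_Poincare_def by blast
next
  assume wsp: "weak_super_Poincare \<alpha> \<mu>"
  define S where "S r = {B. B \<ge> 0 \<and> (\<forall>f\<in>\<F>. (\<integral>x. (f x)\<^sup>2 \<partial>\<mu>) \<le> r * \<E> f + B * (\<integral>x. \<bar>f x\<bar> \<partial>\<mu>)\<^sup>2)}" for r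
  define \<beta> where "\<beta> r = Inf (S r) + 1" for r
  have up: "B' \<in> S r" if "B \<in> S r" "B \<le> B'" for B B' r
    using that unfolding S_def
    by (auto, meson add_left_mono mult_right_mono order_trans zero_le_power2)
  have ne: "S r \<noteq> {}" if "r > 0" for r
  proof -
    obtain B where B: "\<forall>f\<in>\<F>. (\<integral>x. (f x)\<^sup>2 \<partial>\<mu>) \<le> r * \<E> f + B * (\<integral>x. \<bar>f x\<bar> \<partial>\<mu>)\<^sup>2"
      using wsp \<open>r > 0\<close> unfolding weak_super_Poincare_def by blast
    have "B * z\<^sup>2 \<le> max 0 B * z\<^sup>2" for z :: real by (intro mult_right_mono) auto
    with B have "max 0 B \<in> S r" unfolding S_def by (auto, meson add_left_mono order_trans)
    then show ?thesis by auto
  qed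
  have bdd: "bdd_below (S r)" for r by (auto simp: S_def bdd_below_def)
  have beta: "\<beta> r \<in> S r" if r: "r > 0" for r
  proof -
    obtain B where "B \<in> S r" "B < Inf (S r) + 1"
      using cInf_lessD[OF ne[OF r], of "Inf (S r) + 1"] by auto
    then show ?thesis using up by (auto simp: \<beta>_def)
  qed
  have pos: "\<beta> r > 0" if "r > 0" for r
    using cInf_greatest[OF ne[OF that], of 0] by (auto simp: \<beta>_def S_def)
  have anti: "\<beta> s \<le> \<beta> r" if "0 < r" "r \<le> s" for r s
  proof -
    have "S r \<subseteq> S s"
      unfolding S_def using that form_nonneg domainD(1)
      by (auto, meson add_right_mono mult_right_mono order_trans)
    then show ?thesis unfolding \<beta>_def using cInf_superset_mono[OF ne[OF that(1)] bdd] by auto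
  qed
  have "super_Poincare \<alpha> \<mu> \<beta>"
    unfolding super_Poincare_def
  proof (intro conjI allI impI ballI)
    show "antimono_on {0<..} \<beta>" by (auto intro!: monotone_onI anti)
    show "(\<integral>x. (f x)\<^sup>2 \<partial>\<mu>) \<le> r * \<E> f + \<beta> r * (\<integral>x. \<bar>f x\<bar> \<partial>\<mu>)\<^sup>2" if "f \<in> \<F>" "r > 0" for f r
      using beta[OF that(2)] that(1) by (auto simp: S_def)
  qed (rule pos)
  then show "\<exists>\<beta>. super_Poincare \<alpha> \<mu> \<beta>" by blast
qed

text \<open>A sublinear \<open>\<theta>\<close> lies below an affine function of any positive slope
  \<open>r\<close>, and all terms of the weak form are homogeneous of degree two, so scaling to unit
  L1 norm loses nothing.\<close>

lemma Nash_type_imp_weak: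
  assumes "Nash_type \<alpha> \<mu> \<theta>"
  shows "weak_super_Poincare \<alpha> \<mu>"
  unfolding weak_super_Poincare_def
proof (intro allI impI)
  fix r :: real assume "r > 0"
  have \<theta>: "\<forall>r\<ge>0. \<theta> r > 0" "mono_on {0..} \<theta>" "((\<lambda>r. \<theta> r / r) \<longlongrightarrow> 0) at_top"
    "\<And>f. f \<in> \<F> \<Longrightarrow> (\<integral>x. \<bar>f x\<bar> \<partial>\<mu>) = 1 \<Longrightarrow> (\<integral>x. (f x)\<^sup>2 \<partial>\<mu>) \<le> \<theta> (\<E> f)"
    using assms by (auto simp: Nash_type_def)
  have "eventually (\<lambda>s. \<theta> s / s < r \<and> s > 0) at_top"
    using order_tendstoD(2)[OF \<theta>(3) \<open>r > 0\<close>] eventually_gt_at_top[of 0] by (rule eventually_conj)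
  then obtain S where S: "\<And>s. s \<ge> S \<Longrightarrow> \<theta> s / s < r \<and> s > 0"
    by (auto simp: eventually_at_top_linorder)
  have S0: "S > 0" using S by blast
  \<comment> \<open>Beyond \<open>S\<close> the quotient is below \<open>r\<close>; before
    \<open>S\<close> monotonicity gives the constant \<open>\<theta> S\<close>.\<close>
  have bound: "\<theta> s \<le> r * s + \<theta> S" if "s \<ge> 0" for s
  proof (cases "s \<ge> S")
    case True
    then have "s > 0" "\<theta> s / s < r" using S[of s] by auto
    then have "\<theta> s \<le> r * s" by (simp add: pos_divide_less_eq)
    moreover have "\<theta> S > 0" using \<theta>(1) S0 by auto
    ultimately show ?thesis by linarith
  next
    case False
    then have "\<theta> s \<le> \<theta> S" using \<theta>(2) that S0 by (auto simp: mono_on_def)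
    moreover have "0 \<le> r * s" using that \<open>r > 0\<close> by auto
    ultimately show ?thesis by linarith
  qed
  show "\<exists>B. \<forall>f\<in>\<F>. (\<integral>x. (f x)\<^sup>2 \<partial>\<mu>) \<le> r * \<E> f + B * (\<integral>x. \<bar>f x\<bar> \<partial>\<mu>)\<^sup>2"
  proof (intro exI ballI)
    fix f assume f: "f \<in> \<F>"
    define m where "m = (\<integral>x. \<bar>f x\<bar> \<partial>\<mu>)"
    have "m \<ge> 0" by (auto simp: m_def)
    show "(\<integral>x. (f x)\<^sup>2 \<partial>\<mu>) \<le> r * \<E> f + \<theta> S * (\<integral>x. \<bar>f x\<bar> \<partial>\<mu>)\<^sup>2"
    proof (cases "m = 0")
      case True
      then show ?thesis
        using L1_norm_zero_imp_L2_zero[OF f] form_nonneg[OF domainD(1)[OF f]] \<open>r > 0\<close> by (auto simp: m_def)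
    next
      case False
      then have m: "m > 0" using \<open>m \<ge> 0\<close> by auto
      let ?g = "\<lambda>x. (1 / m) * f x"
      have "(\<integral>x. \<bar>?g x\<bar> \<partial>\<mu>) = 1"
        using m by (simp add: abs_mult) (simp add: m_def)
      then have "(\<integral>x. (?g x)\<^sup>2 \<partial>\<mu>) \<le> \<theta> (\<E> ?g)" by (intro \<theta>(4) domain_cmult f)
      also have "\<dots> \<le> r * \<E> ?g + \<theta> S"
        by (intro bound form_nonneg domainD domain_cmult f)
      also have "\<E> ?g = \<E> f / m\<^sup>2" using domain_cmult(2)[OF f, of "1 / m"] by (simp add: power_divide)
      also have "(\<integral>x. (?g x)\<^sup>2 \<partial>\<mu>) = (\<integral>x. (f x)\<^sup>2 \<partial>\<mu>) / m\<^sup>2" by (simp add: power_divide)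
      finally show ?thesis using m by (simp add: field_simps flip: m_def)
    qed
  qed
qed

text \<open>For unit L1 norm the super-Poincare inequality bounds the L2 norm by every affine
  function r s + \<beta> r of the energy s, hence by their infimum, a concave conjugate of the rate.
  The summand 1 makes \<open>\<theta>\<close> strictly positive.\<close>

lemma weak_imp_Nash_type:
  assumes "weak_super_Poincare \<alpha> \<mu>"
  shows "\<exists>\<theta>. Nash_type \<alpha> \<mu> \<theta>"
proof -
  obtain \<beta> where "super_Poincare \<alpha> \<mu> \<beta>" using assms super_Poincare_iff_weak by blast
  then have pos: "\<And>r. r > 0 \<Longrightarrow> \<beta> r > 0"
    and sp: "\<And>f r. f \<in> \<F> \<Longrightarrow> r > 0 \<Longrightarrow> (\<integral>x. (f x)\<^sup>2 \<partial>\<mu>) \<le> r * \<E> f + \<beta> r * (\<integral>x. \<bar>f x\<bar> \<partial>\<mu>)\<^sup>2"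
    by (auto simp: super_Poincare_def)
  define \<theta> where "\<theta> s = 1 + (INF r\<in>{0<..}. r * s + \<beta> r)" for s
  have nn: "0 \<le> r * s + \<beta> r" if "r > 0" "s \<ge> 0" for r s
    using pos[OF that(1)] that by (auto intro!: add_nonneg_nonneg less_imp_le[of 0 "\<beta> r"])
  have bdd: "bdd_below ((\<lambda>r. r * s + \<beta> r) ` {0<..})" if "s \<ge> 0" for s
    using nn that by (auto simp: bdd_below_def intro!: exI[of _ 0])
  have le: "\<theta> s \<le> 1 + (r * s + \<beta> r)" if "s \<ge> 0" "r > 0" for s r
    unfolding \<theta>_def using that by (auto intro!: cINF_lower bdd)
  have ge: "\<theta> s \<ge> 1 + c" if "\<And>r. r > 0 \<Longrightarrow> c \<le> r * s + \<beta> r" for s c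
    unfolding \<theta>_def using that by (auto intro!: cINF_greatest)
  have "Nash_type \<alpha> \<mu> \<theta>"
    unfolding Nash_type_def
  proof (intro conjI allI impI ballI)
    show "\<theta> s > 0" if "s \<ge> 0" for s using ge[of 0 s] nn that by force
    show "mono_on {0..} \<theta>"
    proof (rule mono_onI)
      fix s t :: real assume st: "s \<in> {0..}" "s \<le> t"
      have "1 + (\<theta> s - 1) \<le> \<theta> t"
      proof (rule ge)
        fix r :: real assume "r > 0"
        then have "\<theta> s \<le> 1 + (r * s + \<beta> r)" "r * s \<le> r * t" using le st by auto
        then show "\<theta> s - 1 \<le> r * t + \<beta> r" by linarith
      qed
      then show "\<theta> s \<le> \<theta> t" by simp
    qed
    show "((\<lambda>s. \<theta> s / s) \<longlongrightarrow> 0) at_top"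
    proof (rule tendstoI)
      fix e :: real assume "e > 0"
      \<comment> \<open>Slope \<open>e/2\<close> uses half of the allowed growth; the other half
        absorbs the constant \<open>b\<close> as soon as s > 2 b / e.\<close>
      define b where "b = 1 + \<beta> (e/2)"
      have b: "b > 0" using pos[of "e/2"] \<open>e > 0\<close> by (simp add: b_def)
      have "eventually (\<lambda>s. s > 2 * b / e) at_top" by (rule eventually_gt_at_top)
      then show "eventually (\<lambda>s. dist (\<theta> s / s) 0 < e) at_top"
      proof eventually_elim
        case (elim s)
        have "2 * b / e > 0" using b \<open>e > 0\<close> by simp
        then have s: "s > 0" using elim by linarith
        have "2 * b < e * s" using elim \<open>e > 0\<close> by (simp add: field_simps)
        then have "\<theta> s < e * s" using le[of s "e/2"] s \<open>e > 0\<close> by (simp add: b_def)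
        moreover have "\<theta> s > 0" using ge[of 0 s] nn s by force
        ultimately show ?case using s by (simp add: field_simps)
      qed
    qed
    show "(\<integral>x. (f x)\<^sup>2 \<partial>\<mu>) \<le> \<theta> (\<E> f)" if "f \<in> \<F>" "(\<integral>x. \<bar>f x\<bar> \<partial>\<mu>) = 1" for f
      using ge[of "(\<integral>x. (f x)\<^sup>2 \<partial>\<mu>)" "\<E> f"] sp[OF that(1)] that(2) by force
  qed
  then show ?thesis by blast
qed

text \<open>Where \<open>f\<^sup>2\<close> is large, \<open>F\<close> exceeds a large
  \<open>N\<close> and the F-Sobolev integrand dominates \<open>N * f\<^sup>2\<close>; where
  \<open>f\<^sup>2 < s\<close>, one factor |f| is at most sqrt s and the L1 norm takes over.\<close>

lemma F_Sobolev_imp_weak: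
  assumes "F_Sobolev \<alpha> \<mu> F"
  shows "weak_super_Poincare \<alpha> \<mu>"
  unfolding weak_super_Poincare_def
proof (intro allI impI)
  fix r :: real assume "r > 0"
  obtain C1 C2 where C: "C1 > 0" "C2 \<ge> 0"
    and FS: "\<And>f. f \<in> \<F> \<Longrightarrow> (\<integral>x. (f x)\<^sup>2 \<partial>\<mu>) = 1 \<Longrightarrow> integrable \<mu> (\<lambda>x. (f x)\<^sup>2 * F ((f x)\<^sup>2)) \<and>
        (\<integral>x. (f x)\<^sup>2 * F ((f x)\<^sup>2) \<partial>\<mu>) \<le> C1 * \<E> f + C2"
    using assms by (auto simp: F_Sobolev_def)
  have monoF: "mono_on {0<..} F" and limF: "filterlim F at_top at_top"
    and "bdd_above ((\<lambda>r. \<bar>r * F r\<bar>) ` {0<..1})"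
    using assms by (auto simp: F_Sobolev_def)
  then obtain k where "\<forall>t\<in>{0<..1}. \<bar>t * F t\<bar> \<le> k" by (auto simp: bdd_above_def)
  then have k: "\<And>t. 0 < t \<Longrightarrow> t \<le> 1 \<Longrightarrow> \<bar>t * F t\<bar> \<le> k" by auto
  have k0: "k \<ge> 0" using k[of 1] by auto
  \<comment> \<open>Compensates the possible negative part of t F(t): on (0, 1] by the bound
    \<open>k\<close>, beyond 1 because F(t) is at least F(1), hence at least -k.\<close>
  have low: "t * F t + k * (1 + t) \<ge> 0" if "t \<ge> 0" for t
  proof (cases "t \<le> 1")
    case True
    have "k * (1 + t) \<ge> k" using that k0 by (simp add: algebra_simps)
    moreover have "t * F t \<ge> - k" using k[of t] that True k0 by (cases "t = 0") auto
    ultimately show ?thesis by linarith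
  next
    case False
    then have "F 1 \<le> F t" using monoF by (auto simp: mono_on_def)
    moreover have "F 1 \<ge> - k" using k[of 1] by auto
    ultimately have "t * (F t + k) \<ge> 0" using that by (intro mult_nonneg_nonneg) auto
    then show ?thesis using k0 by (simp add: algebra_simps)
  qed
  \<comment> \<open>The first entry makes \<open>C2 + 2 * k\<close> at most N / 4, where 2 k is the
    integral of k (1 + f^2) for normalized \<open>f\<close>; the second makes \<open>C1\<close> at
    most N r / 2.\<close>
  define N where "N = max (4 * (C2 + 2 * k) + 1) (2 * C1 / r)"
  have N: "N \<ge> 4 * (C2 + 2 * k) + 1" "N \<ge> 2 * C1 / r" unfolding N_def by auto
  have N0: "N > 0" using N(1) C k0 by auto
  obtain s0 where s0: "\<And>t. t \<ge> s0 \<Longrightarrow> F t \<ge> N"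
    using limF unfolding filterlim_at_top eventually_at_top_linorder by blast
  define s where "s = max s0 1"
  have s: "s \<ge> 1" "\<And>t. t \<ge> s \<Longrightarrow> F t \<ge> N" using s0 by (auto simp: s_def)
  have pt: "N * t\<^sup>2 \<le> t\<^sup>2 * F (t\<^sup>2) + k * (1 + t\<^sup>2) + N * sqrt s * \<bar>t\<bar>" for t
  proof (cases "t\<^sup>2 \<ge> s")
    case True
    then have "t\<^sup>2 * N \<le> t\<^sup>2 * F (t\<^sup>2)" by (intro mult_left_mono s) auto
    moreover have "k * (1 + t\<^sup>2) \<ge> 0" "N * sqrt s * \<bar>t\<bar> \<ge> 0" using k0 N0 s(1) by auto
    ultimately show ?thesis by (simp add: mult.commute)
  next
    case False
    then have "\<bar>t\<bar> \<le> sqrt s" by (simp add: real_le_rsqrt)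
    then have "N * (\<bar>t\<bar> * \<bar>t\<bar>) \<le> N * (sqrt s * \<bar>t\<bar>)"
      using N0 by (intro mult_left_mono mult_right_mono) auto
    then have "N * t\<^sup>2 \<le> N * sqrt s * \<bar>t\<bar>" by (simp add: power2_eq_square)
    then show ?thesis using low[of "t\<^sup>2"] by simp
  qed
  have norm1: "1 \<le> r * \<E> f + 2 * s * (\<integral>x. \<bar>f x\<bar> \<partial>\<mu>)\<^sup>2" if f: "f \<in> \<F>" "(\<integral>x. (f x)\<^sup>2 \<partial>\<mu>) = 1" for f
  proof -
    let ?m = "\<integral>x. \<bar>f x\<bar> \<partial>\<mu>"
    note i = domainD(2)[OF f(1)] domain_abs_integrable(2)[OF f(1)] FS[OF f, THEN conjunct1]
    have "N = (\<integral>x. N * (f x)\<^sup>2 \<partial>\<mu>)" using f(2) by simp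
    also have "\<dots> \<le> (\<integral>x. (f x)\<^sup>2 * F ((f x)\<^sup>2) + k * (1 + (f x)\<^sup>2) + N * sqrt s * \<bar>f x\<bar> \<partial>\<mu>)"
      by (intro integral_mono pt) (use i in auto)
    also have "\<dots> = (\<integral>x. (f x)\<^sup>2 * F ((f x)\<^sup>2) \<partial>\<mu>) + 2 * k + N * sqrt s * ?m"
      using i f(2) by simp
    also have "\<dots> \<le> C1 * \<E> f + C2 + 2 * k + N * sqrt s * ?m" using FS[OF f] by simp
    finally have 1: "N \<le> C1 * \<E> f + N / 4 + N * sqrt s * ?m" using N(1) by simp
    \<comment> \<open>Young's inequality, with 1 / 4 chosen so that N / 2 survives on the left after
      both losses of N / 4. Dividing by N / 2 yields slope \<open>r\<close> and constant
      \<open>2 * s\<close>.\<close>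
    have "sqrt s * ?m \<le> 1 / 4 + (sqrt s * ?m)\<^sup>2"
      using zero_le_power2[of "sqrt s * ?m - 1 / 2"] by (simp add: power2_eq_square algebra_simps)
    then have "N * (sqrt s * ?m) \<le> N * (1 / 4 + s * ?m\<^sup>2)"
      using N0 s(1) by (intro mult_left_mono) (auto simp: power_mult_distrib)
    with 1 have "N * (1 / 2) \<le> C1 * \<E> f + N * (s * ?m\<^sup>2)" by (simp add: algebra_simps)
    moreover have "C1 * \<E> f \<le> N * r / 2 * \<E> f"
      using N(2) \<open>r > 0\<close> form_nonneg[OF domainD(1)[OF f(1)]] by (intro mult_right_mono) (auto simp: field_simps)
    ultimately have "N * (1 / 2) \<le> N * (r / 2 * \<E> f + s * ?m\<^sup>2)" by (simp add: algebra_simps)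
    then show ?thesis using N0 by simp
  qed
  show "\<exists>B. \<forall>f\<in>\<F>. (\<integral>x. (f x)\<^sup>2 \<partial>\<mu>) \<le> r * \<E> f + B * (\<integral>x. \<bar>f x\<bar> \<partial>\<mu>)\<^sup>2"
  proof (intro exI ballI)
    fix f assume f: "f \<in> \<F>"
    define m where "m = (\<integral>x. (f x)\<^sup>2 \<partial>\<mu>)"
    have "m \<ge> 0" by (auto simp: m_def)
    show "(\<integral>x. (f x)\<^sup>2 \<partial>\<mu>) \<le> r * \<E> f + 2 * s * (\<integral>x. \<bar>f x\<bar> \<partial>\<mu>)\<^sup>2"
    proof (cases "m = 0")
      case True
      then show ?thesis
        using form_nonneg[OF domainD(1)[OF f]] \<open>r > 0\<close> s(1) by (simp add: m_def)
    next
      case False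
      then have m: "m > 0" using \<open>m \<ge> 0\<close> by auto
      let ?g = "\<lambda>x. (1 / sqrt m) * f x"
      have "(\<integral>x. (?g x)\<^sup>2 \<partial>\<mu>) = 1"
        using m by (simp add: power_divide) (simp add: m_def)
      then have "1 \<le> r * \<E> ?g + 2 * s * (\<integral>x. \<bar>?g x\<bar> \<partial>\<mu>)\<^sup>2"
        by (intro norm1 domain_cmult f)
      also have "\<E> ?g = \<E> f / m" using domain_cmult(2)[OF f, of "1 / sqrt m"] m by (simp add: power_divide)
      also have "(\<integral>x. \<bar>?g x\<bar> \<partial>\<mu>) = (\<integral>x. \<bar>f x\<bar> \<partial>\<mu>) / sqrt m" using m by (simp add: abs_mult)
      finally show ?thesis using m by (simp add: power_divide field_simps flip: m_def)
    qed
  qed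
qed

end

section \<open>Maz'ya truncation into dyadic slices\<close>

definition dyadic_slice :: "real \<Rightarrow> nat \<Rightarrow> real \<Rightarrow> real" where
  "dyadic_slice c k u = min (c * 2 ^ k) (max 0 (u - c * 2 ^ k))"

lemma dyadic_slice_diff_le: "\<bar>dyadic_slice c k u - dyadic_slice c k v\<bar> \<le> \<bar>u - v\<bar>"
  unfolding dyadic_slice_def by linarith

text \<open>Slice k covers the values from c 2^k to c 2^(k+1), so the slices tile the range from c
  to c 2^m. The part below c is missing and has to be paid for separately.\<close>

lemma sum_dyadic_slice:
  assumes "c > 0"
  shows "(\<Sum>k<m. dyadic_slice c k u) = min (c * 2 ^ m - c) (max 0 (u - c))"
proof (induction m)
  case (Suc m)
  define P where "P = c * 2 ^ m"
  have "P \<ge> c" using assms by (simp add: P_def)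
  then have "min (P - c) (max 0 (u - c)) + min P (max 0 (u - P)) = min (2 * P - c) (max 0 (u - c))"
    using assms by linarith
  then show ?case using Suc by (simp add: dyadic_slice_def P_def mult_ac)
qed simp

text \<open>For v \<le> u all increments are nonnegative and add up to at most u - v, and a sum of
  squares of nonnegative numbers is at most the square of their sum. This is what makes the energies
  of the slices summable.\<close>

lemma sum_dyadic_slice_square_le:
  assumes "c > 0"
  shows "(\<Sum>k<m. (dyadic_slice c k u - dyadic_slice c k v)\<^sup>2) \<le> (u - v)\<^sup>2"
proof -
  have ord: "(\<Sum>k<m. (dyadic_slice c k u - dyadic_slice c k v)\<^sup>2) \<le> (u - v)\<^sup>2" if "v \<le> u" for u v
  proof -
    define d where "d k = dyadic_slice c k u - dyadic_slice c k v" for k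
    define S where "S = (\<Sum>k<m. d k)"
    have d: "d k \<ge> 0" for k using that unfolding d_def dyadic_slice_def by linarith
    have "S = min (c * 2 ^ m - c) (max 0 (u - c)) - min (c * 2 ^ m - c) (max 0 (v - c))"
      by (simp add: S_def d_def sum_subtractf sum_dyadic_slice[OF assms])
    then have S: "S \<le> u - v" using that by linarith
    have S0: "S \<ge> 0" unfolding S_def by (intro sum_nonneg d)
    have "(\<Sum>k<m. (d k)\<^sup>2) \<le> (\<Sum>k<m. d k * S)"
      unfolding power2_eq_square S_def by (intro sum_mono mult_left_mono member_le_sum d) auto
    also have "\<dots> = S * S" by (simp add: S_def sum_distrib_right)
    also have "\<dots> \<le> (u - v) * (u - v)" using S S0 by (intro mult_mono) auto
    finally show ?thesis by (simp add: d_def power2_eq_square)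
  qed
  show ?thesis
  proof (cases "v \<le> u")
    case False
    then show ?thesis using ord[of u v] by (simp add: power2_commute)
  qed (rule ord)
qed

lemma sum_energy_dyadic_slice_le:
  assumes [measurable]: "f \<in> borel_measurable borel" and "c > 0"
  shows "(\<Sum>k<m. energy \<alpha> (\<lambda>x. dyadic_slice c k (f x))) \<le> energy \<alpha> f"
proof -
  have [measurable]: "dyadic_slice c k \<in> borel_measurable borel" for k
    unfolding dyadic_slice_def by measurable
  have "(\<Sum>k<m. jump_energy \<alpha> (\<lambda>x. dyadic_slice c k (f x)) x) \<le> jump_energy \<alpha> f x" for x
  proof -
    have "(\<Sum>k<m. jump_energy \<alpha> (\<lambda>x. dyadic_slice c k (f x)) x)
      = (\<integral>\<^sup>+y. (\<Sum>k<m. ennreal ((dyadic_slice c k (f x) - dyadic_slice c k (f y))\<^sup>2 / \<bar>x - y\<bar> powr (1 + \<alpha>))) \<partial>lborel)"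
      unfolding jump_energy_def by (subst nn_integral_sum) auto
    also have "\<dots> \<le> jump_energy \<alpha> f x"
      unfolding jump_energy_def
      by (intro nn_integral_mono)
        (simp add: sum_ennreal sum_divide_distrib[symmetric] ennreal_leI divide_right_mono
          sum_dyadic_slice_square_le[OF assms(2)])
    finally show ?thesis .
  qed
  then show ?thesis
    unfolding energy_def by (subst nn_integral_sum[symmetric]) (auto intro!: nn_integral_mono)
qed

text \<open>A discrete layer cake. Level 2 c 2^k is where slice k becomes full, and 16 (c 2^k)^2 is
  the square of the upper end 4 c 2^k of the next dyadic block. Capping \<open>u\<close> lets the
  induction add one block at a time; 4 c^2 covers the values up to 2 c.\<close>

lemma square_le_dyadic_level_sum:
  fixes c u :: real
  assumes "c > 0" "u \<ge> 0"
  shows "(min u (2 * c * 2 ^ m))\<^sup>2 \<le> 4 * c\<^sup>2 + (\<Sum>k<m. 16 * (c * 2 ^ k)\<^sup>2 * indicator {2 * c * 2 ^ k..} u)"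
proof (induction m)
  case 0
  have "(min u (2 * c))\<^sup>2 \<le> (2 * c)\<^sup>2" using assms by (intro power_mono) auto
  then show ?case by (simp add: power_mult_distrib)
next
  case (Suc m)
  show ?case
  proof (cases "u \<ge> 2 * c * 2 ^ m")
    case True
    have "(min u (2 * c * 2 ^ Suc m))\<^sup>2 \<le> (4 * (c * 2 ^ m))\<^sup>2" using assms by (intro power_mono) auto
    also have "\<dots> = 16 * (c * 2 ^ m)\<^sup>2 * indicator {2 * c * 2 ^ m..} u"
      using True by (simp add: power_mult_distrib)
    finally have "(min u (2 * c * 2 ^ Suc m))\<^sup>2 \<le> 16 * (c * 2 ^ m)\<^sup>2 * indicator {2 * c * 2 ^ m..} u" .
    moreover have "0 \<le> 4 * c\<^sup>2 + (\<Sum>k<m. 16 * (c * 2 ^ k)\<^sup>2 * indicator {2 * c * 2 ^ k..} u)"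
      by (intro add_nonneg_nonneg sum_nonneg) auto
    ultimately show ?thesis by simp
  next
    case False
    moreover have "2 * c * 2 ^ m \<le> 2 * c * 2 ^ Suc m" using assms by simp
    ultimately have "min u (2 * c * 2 ^ Suc m) = min u (2 * c * 2 ^ m)" by linarith
    then show ?thesis using Suc False by simp
  qed
qed

text \<open>Supplies points of finite \<open>jump_energy\<close> arbitrarily close to the ends of
  [-n, n].\<close>

lemma AE_lborel_witness:
  fixes p q :: real
  assumes "AE x in lborel. x \<in> D" "p < q"
  shows "\<exists>y\<in>D. p < y \<and> y < q"
proof (rule ccontr)
  assume "\<not> ?thesis"
  with assms(1) have "AE x in lborel. x \<notin> {p<..<q}" by (auto elim!: eventually_mono)
  then have "emeasure lborel {p<..<q} = 0" by (subst (asm) AE_iff_null_sets[symmetric]) (auto simp: null_sets_def)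
  then show False using assms(2) by simp
qed

section \<open>The tail condition implies the weak form\<close>

context time_changed_stable
begin

definition tail :: "real \<Rightarrow> real" where
  "tail \<rho> = measure \<mu> (- {-\<rho><..<\<rho>})"

text \<open>Let \<open>R\<close> be the infimum of |x| over the points of \<open>D\<close> in the
  level set. Hoelder continuity between such a point and a zero near the closer end of [-n, n]
  bounds t^2 by a multiple of (R - n)^(\<alpha> - 1) E, while up to a null set the level set lies
  where |x| \<ge> R, so its mass is at most \<open>tail R\<close>. The hypothesis on the tail at
  \<open>R\<close> finishes.\<close>

lemma level_set_bound:
  assumes [measurable]: "f \<in> borel_measurable borel"
    and "energy \<alpha> f \<le> ennreal E" "E \<ge> 0"
    and D: "AE x in lborel. x \<in> D" "\<And>x. x \<in> D \<Longrightarrow> jump_energy \<alpha> f x < \<infinity>"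
    and zero: "\<And>x. x \<in> D \<Longrightarrow> \<bar>x\<bar> \<le> n \<Longrightarrow> f x = 0"
    and "n > 0" "t > 0" "\<delta> \<ge> 0"
    and tail: "\<And>\<rho>. \<rho> > n \<Longrightarrow> (\<rho> - n) powr (\<alpha> - 1) * tail \<rho> \<le> \<delta>"
  shows "t\<^sup>2 * measure \<mu> {x. f x \<ge> t} \<le> hoelder_const \<alpha> * \<delta> * E"
proof -
  let ?K = "hoelder_const \<alpha>"
  have K: "?K > 0" using hoelder_const_pos alpha by blast
  define S where "S = {x \<in> D. f x \<ge> t}"
  show ?thesis
  proof (cases "S = {}")
    case True
    then have "AE x in \<mu>. x \<notin> {x. f x \<ge> t}"
      using AE_speed_measure[OF D(1)] by (auto simp: S_def elim!: eventually_mono)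
    then have "measure \<mu> {x. f x \<ge> t} = 0"
      by (subst (asm) AE_iff_measurable[OF _ refl]) (auto simp: measure_def)
    then show ?thesis using K assms by simp
  next
    case False
    define R where "R = Inf (abs ` S)"
    have Sn: "\<bar>x\<bar> > n" if "x \<in> S" for x
      using that zero[of x] \<open>t > 0\<close> by (force simp: S_def)
    have bdd: "bdd_below (abs ` S)" by (rule bdd_belowI[of _ 0]) auto
    have Rn: "R \<ge> n" unfolding R_def using False Sn by (intro cInf_greatest) (auto intro: less_imp_le)
    have R: "R \<le> \<bar>x\<bar>" if "x \<in> S" for x unfolding R_def using that by (intro cInf_lower bdd) auto
    \<comment> \<open>Neither \<open>R\<close> nor the end of [-n, n] need be reached within
      \<open>D\<close>; one \<epsilon> is spent on \<open>x\<close> and one on \<open>y\<close>. The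
      limit \<epsilon> -> 0 removes both.\<close>
    have near: "t\<^sup>2 \<le> ?K * (R - n + 2 * \<epsilon>) powr (\<alpha> - 1) * E" if e: "0 < \<epsilon>" "\<epsilon> < n" for \<epsilon>
    proof -
      obtain x where x: "x \<in> S" "\<bar>x\<bar> < R + \<epsilon>"
        using cInf_lessD[of "abs ` S" "R + \<epsilon>"] False e by (auto simp: R_def)
      obtain y where y: "y \<in> D" "\<bar>y\<bar> \<le> n" "\<bar>x - y\<bar> \<le> R - n + 2 * \<epsilon>"
      proof (cases "x > 0")
        case True
        obtain y where "y \<in> D" "n - \<epsilon> < y" "y < n" using AE_lborel_witness[OF D(1), of "n - \<epsilon>" n] e by auto
        then show ?thesis using True x e Sn[OF x(1)] by (intro that[of y]) auto
      next
        case False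
        obtain y where "y \<in> D" "- n < y" "y < - n + \<epsilon>" using AE_lborel_witness[OF D(1), of "- n" "- n + \<epsilon>"] e by auto
        then show ?thesis using False x e Sn[OF x(1)] by (intro that[of y]) auto
      qed
      have "t\<^sup>2 \<le> (f x)\<^sup>2" using x(1) \<open>t > 0\<close> by (intro power_mono) (auto simp: S_def)
      also have "\<dots> = (f x - f y)\<^sup>2" using zero[OF y(1,2)] by simp
      also have "\<dots> \<le> ?K * \<bar>x - y\<bar> powr (\<alpha> - 1) * E"
        using x y by (intro hoelder assms alpha D) (auto simp: S_def)
      also have "\<dots> \<le> ?K * (R - n + 2 * \<epsilon>) powr (\<alpha> - 1) * E"
        using y K alpha \<open>E \<ge> 0\<close> by (intro mult_right_mono mult_left_mono powr_mono2) auto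
      finally show ?thesis .
    qed
    have "((\<lambda>\<epsilon>. R - n + 2 * \<epsilon>) \<longlongrightarrow> R - n + 2 * 0) (at_right 0)"
      by (intro tendsto_intros)
    then have "((\<lambda>\<epsilon>. (R - n + 2 * \<epsilon>) powr (\<alpha> - 1)) \<longlongrightarrow> (R - n + 2 * 0) powr (\<alpha> - 1)) (at_right 0)"
      by (rule tendsto_powr'[OF _ tendsto_const])
         (use alpha Rn in \<open>auto simp: eventually_at_right_less intro: eventually_mono[OF eventually_at_right_less]\<close>)
    then have "((\<lambda>\<epsilon>. ?K * (R - n + 2 * \<epsilon>) powr (\<alpha> - 1) * E) \<longlongrightarrow> ?K * (R - n + 2 * 0) powr (\<alpha> - 1) * E) (at_right 0)"
      by (intro tendsto_mult_right tendsto_mult_left)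
    moreover have "eventually (\<lambda>\<epsilon>. t\<^sup>2 \<le> ?K * (R - n + 2 * \<epsilon>) powr (\<alpha> - 1) * E) (at_right 0)"
      using eventually_at_right_real[OF \<open>n > 0\<close>] by eventually_elim (use near in auto)
    ultimately have "t\<^sup>2 \<le> ?K * (R - n + 2 * 0) powr (\<alpha> - 1) * E"
      by (rule tendsto_lowerbound) simp
    then have t2: "t\<^sup>2 \<le> ?K * (R - n) powr (\<alpha> - 1) * E" by simp
    have "t\<^sup>2 > 0" using \<open>t > 0\<close> by simp
    \<comment> \<open>If \<open>R = n\<close>, the right-hand side of \<open>t2\<close> would be 0.
      The tail hypothesis is available only strictly beyond \<open>n\<close>.\<close>
    with t2 have "R \<noteq> n" by auto
    with Rn have "R > n" by simp
    have "measure \<mu> {x. f x \<ge> t} \<le> tail R"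
      unfolding tail_def
    proof (rule finite_measure_mono_AE)
      show "AE x in \<mu>. x \<in> {x. t \<le> f x} \<longrightarrow> x \<in> - {- R<..<R}"
        using AE_speed_measure[OF D(1)]
      proof eventually_elim
        case (elim x)
        then show ?case using R[of x] by (auto simp: S_def)
      qed
    qed auto
    then have "t\<^sup>2 * measure \<mu> {x. f x \<ge> t} \<le> ?K * (R - n) powr (\<alpha> - 1) * E * tail R"
      using K \<open>E \<ge> 0\<close> by (intro mult_mono t2) auto
    also have "\<dots> = ?K * E * ((R - n) powr (\<alpha> - 1) * tail R)" by simp
    also have "\<dots> \<le> ?K * E * \<delta>" using K \<open>E \<ge> 0\<close> by (intro mult_left_mono tail \<open>R > n\<close>) auto
    finally show ?thesis by (simp add: mult_ac)
  qed
qed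

text \<open>Maz'ya's truncation argument: the energies of the dyadic slices add up to at most the energy.\<close>
lemma Hardy_inequality:
  assumes [measurable]: "f \<in> borel_measurable borel" and "\<And>x. f x \<ge> 0"
    and "energy \<alpha> f \<le> ennreal E" "E \<ge> 0"
    and D: "AE x in lborel. x \<in> D" "\<And>x. x \<in> D \<Longrightarrow> jump_energy \<alpha> f x < \<infinity>"
    and zero: "\<And>x. x \<in> D \<Longrightarrow> \<bar>x\<bar> \<le> n \<Longrightarrow> f x = 0"
    and "n > 0" "\<delta> \<ge> 0"
    and tail: "\<And>\<rho>. \<rho> > n \<Longrightarrow> (\<rho> - n) powr (\<alpha> - 1) * tail \<rho> \<le> \<delta>"
  shows "(\<integral>\<^sup>+x. ennreal ((f x)\<^sup>2) \<partial>\<mu>) \<le> ennreal (16 * hoelder_const \<alpha> * \<delta> * E)"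
proof (rule ennreal_le_epsilon)
  fix e :: real assume "e > 0"
  let ?K = "hoelder_const \<alpha>"
  have K: "?K > 0" using hoelder_const_pos alpha by blast
  \<comment> \<open>With this \<open>c\<close> the values of \<open>f\<close> below the lowest level
    cost at most 4 c^2 = e, since \<mu> has total mass 1.\<close>
  define c where "c = sqrt e / 2"
  have c: "c > 0" "4 * c\<^sup>2 = e" using \<open>e > 0\<close> by (auto simp: c_def power_divide)
  have [measurable]: "dyadic_slice c k \<in> borel_measurable borel" for k
    unfolding dyadic_slice_def by measurable
  define g where "g k x = dyadic_slice c k (f x)" for k x
  have [measurable]: "g k \<in> borel_measurable borel" for k unfolding g_def by measurable
  define Ek where "Ek k = enn2real (energy \<alpha> (g k))" for k
  have le: "\<bar>g k x - g k y\<bar> \<le> \<bar>f x - f y\<bar>" for k x y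
    unfolding g_def by (rule dyadic_slice_diff_le)
  have Efin: "energy \<alpha> (g k) < \<infinity>" for k
    using energy_mono[of "g k" f \<alpha>, OF le] assms(3) ennreal_less_top[of E] by (simp add: le_less_trans)
  have Ek: "energy \<alpha> (g k) = ennreal (Ek k)" for k
    using Efin by (simp add: Ek_def)
  have Ek0: "Ek k \<ge> 0" for k by (simp add: Ek_def)
  define A where "A k = {x. 2 * c * 2 ^ k \<le> f x}" for k
  have [measurable]: "A k \<in> sets borel" for k unfolding A_def by measurable
  \<comment> \<open>The set where f \<ge> 2 c 2^k is exactly where slice k attains its height c 2^k,
    so the level set bound applies to the slice with the energy of the slice alone.\<close>
  have lev: "(c * 2 ^ k)\<^sup>2 * measure \<mu> (A k) \<le> ?K * \<delta> * Ek k" for k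
  proof -
    have "A k = {x. g k x \<ge> c * 2 ^ k}"
    proof -
      have "2 * P \<le> u \<longleftrightarrow> P \<le> min P (max 0 (u - P))" if "P > 0" for P u :: real using that by linarith
      from this[of "c * 2 ^ k"] show ?thesis
        using c by (simp add: A_def g_def dyadic_slice_def mult_ac)
    qed
    moreover have "(c * 2 ^ k)\<^sup>2 * measure \<mu> {x. g k x \<ge> c * 2 ^ k} \<le> ?K * \<delta> * Ek k"
    proof (rule level_set_bound[where D=D and n=n])
      show "jump_energy \<alpha> (g k) x < \<infinity>" if "x \<in> D" for x
        using D(2)[OF that] jump_energy_mono[of "g k" f \<alpha> x, OF le] by (rule le_less_trans[rotated])
      show "g k x = 0" if "x \<in> D" "\<bar>x\<bar> \<le> n" for x
        using zero[OF that] c by (simp add: g_def dyadic_slice_def)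
    qed (use assms c Ek Ek0 in auto)
    ultimately show ?thesis by simp
  qed
  \<comment> \<open>Each level is charged to its own slice, so the total is bounded by one copy of
    \<open>E\<close> and not by \<open>m\<close> copies.\<close>
  have part: "(\<Sum>k<m. ennreal (16 * (c * 2 ^ k)\<^sup>2) * emeasure \<mu> (A k)) \<le> ennreal (16 * ?K * \<delta> * E)" for m
  proof -
    have "(\<Sum>k<m. ennreal (Ek k)) \<le> ennreal E"
      using sum_energy_dyadic_slice_le[of f c \<alpha> m] assms(3) c by (simp add: Ek[symmetric] g_def[abs_def])
    then have sE: "(\<Sum>k<m. Ek k) \<le> E" using Ek0 assms(4) by (simp add: sum_ennreal)
    have "(\<Sum>k<m. ennreal (16 * (c * 2 ^ k)\<^sup>2) * emeasure \<mu> (A k))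
        = ennreal (\<Sum>k<m. 16 * ((c * 2 ^ k)\<^sup>2 * measure \<mu> (A k)))"
      by (subst sum_ennreal[symmetric])
         (auto simp: emeasure_eq_measure ennreal_mult[symmetric] mult_ac intro!: sum.cong)
    also have "\<dots> \<le> ennreal (\<Sum>k<m. 16 * (?K * \<delta> * Ek k))"
      by (intro ennreal_leI sum_mono mult_left_mono lev) auto
    also have "(\<Sum>k<m. 16 * (?K * \<delta> * Ek k)) = 16 * ?K * \<delta> * (\<Sum>k<m. Ek k)"
      by (simp only: sum_distrib_left mult.assoc)
    also have "ennreal \<dots> \<le> ennreal (16 * ?K * \<delta> * E)"
      using K assms by (intro ennreal_leI mult_left_mono sE) auto
    finally show ?thesis .
  qed
  have "(\<integral>\<^sup>+x. ennreal ((f x)\<^sup>2) \<partial>\<mu>)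
      \<le> (\<integral>\<^sup>+x. ennreal e + (\<Sum>k. ennreal (16 * (c * 2 ^ k)\<^sup>2) * indicator (A k) x) \<partial>\<mu>)"
  proof (rule nn_integral_mono)
    fix x
    obtain m where "f x / (2 * c) < 2 ^ m" using real_arch_pow[of 2 "f x / (2 * c)"] by auto
    then have "f x = min (f x) (2 * c * 2 ^ m)" using c by (simp add: field_simps min_def)
    then have "(f x)\<^sup>2 \<le> e + (\<Sum>k<m. 16 * (c * 2 ^ k)\<^sup>2 * indicator {2 * c * 2 ^ k..} (f x))"
      using square_le_dyadic_level_sum[OF c(1) assms(2), of x m] c(2) by simp
    then have "ennreal ((f x)\<^sup>2) \<le> ennreal e + ennreal (\<Sum>k<m. 16 * (c * 2 ^ k)\<^sup>2 * indicator {2 * c * 2 ^ k..} (f x))"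
      using \<open>e > 0\<close> by (subst ennreal_plus[symmetric]) (auto intro!: ennreal_leI sum_nonneg)
    also have "ennreal (\<Sum>k<m. 16 * (c * 2 ^ k)\<^sup>2 * indicator {2 * c * 2 ^ k..} (f x))
        = (\<Sum>k<m. ennreal (16 * (c * 2 ^ k)\<^sup>2) * indicator (A k) x)"
      by (subst sum_ennreal[symmetric]) (auto simp: A_def indicator_def intro!: sum.cong)
    also have "\<dots> \<le> (\<Sum>k. ennreal (16 * (c * 2 ^ k)\<^sup>2) * indicator (A k) x)"
      by (rule sum_le_suminf) auto
    finally show "ennreal ((f x)\<^sup>2) \<le> ennreal e + (\<Sum>k. ennreal (16 * (c * 2 ^ k)\<^sup>2) * indicator (A k) x)"
      by (simp add: add_left_mono)
  qed
  also have "\<dots> = ennreal e + (\<Sum>k. ennreal (16 * (c * 2 ^ k)\<^sup>2) * emeasure \<mu> (A k))"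
    by (subst nn_integral_add) (auto simp: nn_integral_suminf nn_integral_cmult_indicator emeasure_UNIV)
  also have "\<dots> \<le> ennreal e + ennreal (16 * ?K * \<delta> * E)"
    by (intro add_left_mono suminf_le_const part) auto
  finally show "(\<integral>\<^sup>+x. ennreal ((f x)\<^sup>2) \<partial>\<mu>) \<le> ennreal (16 * ?K * \<delta> * E) + ennreal e"
    by (simp add: add.commute)
qed

text \<open>Continuity of \<open>a\<close> gives a bound \<open>M\<close> on the compact interval
  [-n, n + h], so the density 1 / a is at least 1 / M there and \<open>m = h / M\<close>
  works.\<close>

lemma interval_measure_lower_bound:
  assumes "n \<ge> 0" "h > 0"
  obtains m where "m > 0" "\<And>x. \<bar>x\<bar> \<le> n \<Longrightarrow> measure \<mu> {x..x + h} \<ge> m"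
proof -
  have "compact (a ` {-n..n + h})"
    by (intro compact_continuous_image continuous_on_subset[OF cont_a]) auto
  then obtain M where M: "\<And>y. y \<in> {-n..n + h} \<Longrightarrow> a y \<le> M"
    by (meson bdd_above.E bounded_imp_bdd_above compact_imp_bounded imageI)
  have M0: "M > 0" using M[of 0] a_pos[of 0] assms by auto
  have "h / M \<le> measure \<mu> {x..x + h}" if x: "\<bar>x\<bar> \<le> n" for x
  proof -
    have "ennreal (h / M) = (\<integral>\<^sup>+y. ennreal (1 / M) * indicator {x..x + h} y \<partial>lborel)"
      using assms M0 by (subst nn_integral_cmult_indicator) (auto simp flip: ennreal_mult')
    also have "\<dots> \<le> (\<integral>\<^sup>+y\<in>{x..x + h}. ennreal (1 / a y) \<partial>lborel)"
    proof (rule nn_integral_mono)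
      fix y
      show "ennreal (1 / M) * indicator {x..x + h} y \<le> ennreal (1 / a y) * indicator {x..x + h} y"
      proof (cases "y \<in> {x..x + h}")
        case True
        then have "a y \<le> M" using x by (intro M) auto
        then have "1 / M \<le> 1 / a y" using a_pos[of y] by (intro divide_left_mono) (auto simp: M0)
        then show ?thesis by (intro mult_right_mono ennreal_leI) auto
      qed simp
    qed
    also have "\<dots> = ennreal (measure \<mu> {x..x + h})"
      by (simp add: emeasure_speed_measure flip: emeasure_eq_measure)
    finally show ?thesis by (simp add: ennreal_le_iff)
  qed
  moreover have "h / M > 0" using assms M0 by simp
  ultimately show ?thesis using that by blast
qed

text \<open>By Hoelder continuity |f| is almost everywhere at least |f x| minus the square root term
  on [x, x + h]; integrating this lower bound against \<mu> over the interval leaves the L1 norm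
  divided by \<open>m\<close>.\<close>

lemma local_sup_bound:
  assumes "f \<in> \<F>" "jump_energy \<alpha> f x < \<infinity>" "h > 0" "m > 0" "measure \<mu> {x..x + h} \<ge> m"
  shows "\<bar>f x\<bar> \<le> (\<integral>y. \<bar>f y\<bar> \<partial>\<mu>) / m + sqrt (hoelder_const \<alpha> * h powr (\<alpha> - 1) * enn2real (energy \<alpha> f))"
proof -
  note f = domainD[OF assms(1)]
  define E where "E = enn2real (energy \<alpha> f)"
  have E: "energy \<alpha> f = ennreal E" "E \<ge> 0" using f(3) by (auto simp: E_def)
  let ?K = "hoelder_const \<alpha>"
  have K: "?K > 0" using hoelder_const_pos alpha by blast
  define s where "s = sqrt (?K * h powr (\<alpha> - 1) * E)"
  have near: "\<bar>f x\<bar> - s \<le> \<bar>f y\<bar>" if "jump_energy \<alpha> f y < \<infinity>" "y \<in> {x..x + h}" for y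
  proof -
    have "(f x - f y)\<^sup>2 \<le> ?K * \<bar>x - y\<bar> powr (\<alpha> - 1) * E"
      by (rule hoelder) (use f assms that alpha E in auto)
    also have "\<dots> \<le> ?K * h powr (\<alpha> - 1) * E"
      using that K alpha \<open>E \<ge> 0\<close> by (intro mult_right_mono mult_left_mono powr_mono2) auto
    finally have "\<bar>f x - f y\<bar> \<le> s" unfolding s_def by (simp add: real_le_rsqrt)
    then show ?thesis by linarith
  qed
  have "\<bar>f x\<bar> - s \<le> (\<integral>y. \<bar>f y\<bar> \<partial>\<mu>) / m"
  proof (cases "\<bar>f x\<bar> - s \<le> 0")
    case True
    moreover have "0 \<le> (\<integral>y. \<bar>f y\<bar> \<partial>\<mu>) / m" using assms by (intro divide_nonneg_pos) auto
    ultimately show ?thesis by linarith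
  next
    case False
    have "(\<bar>f x\<bar> - s) * m \<le> (\<bar>f x\<bar> - s) * measure \<mu> {x..x + h}"
      using False assms by (intro mult_left_mono) auto
    also have "\<dots> = (\<integral>y. (\<bar>f x\<bar> - s) * indicator {x..x + h} y \<partial>\<mu>)" by simp
    also have "\<dots> \<le> (\<integral>y. \<bar>f y\<bar> \<partial>\<mu>)"
    proof (rule integral_mono_AE)
      show "AE y in \<mu>. (\<bar>f x\<bar> - s) * indicator {x..x + h} y \<le> \<bar>f y\<bar>"
        using AE_speed_measure[OF AE_jump_energy_finite[OF f(1,3)]]
        by eventually_elim (use near in \<open>auto simp: indicator_def\<close>)
    qed (use domain_abs_integrable[OF assms(1)] in \<open>auto intro!: integrable_mult_right integrable_real_indicator simp: emeasure_eq_measure\<close>)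
    finally show ?thesis using assms by (simp add: field_simps)
  qed
  then show ?thesis by (simp add: s_def E_def)
qed

lemma tail_condition_iff:
  "tail_condition \<alpha> \<mu> \<longleftrightarrow>
    (\<forall>\<delta>>0. \<exists>n0::nat. \<forall>n\<ge>n0. \<forall>\<rho>>real n. (\<rho> - real n) powr (\<alpha> - 1) * tail \<rho> \<le> \<delta>)"
proof -
  define S where "S n = (SUP x\<in>{x. \<bar>x\<bar> > real n}.
        ennreal ((\<bar>x\<bar> - real n) powr (\<alpha> - 1)) * emeasure \<mu> (- {-\<bar>x\<bar><..<\<bar>x\<bar>}))" for n
  have S: "S n \<le> ennreal \<delta> \<longleftrightarrow> (\<forall>\<rho>>real n. (\<rho> - real n) powr (\<alpha> - 1) * tail \<rho> \<le> \<delta>)" if "\<delta> > 0" for n \<delta>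
  proof -
    have "S n \<le> ennreal \<delta> \<longleftrightarrow> (\<forall>x. \<bar>x\<bar> > real n \<longrightarrow> (\<bar>x\<bar> - real n) powr (\<alpha> - 1) * tail \<bar>x\<bar> \<le> \<delta>)"
      using that by (simp add: S_def SUP_le_iff emeasure_eq_measure tail_def ennreal_le_iff flip: ennreal_mult')
    also have "\<dots> \<longleftrightarrow> (\<forall>\<rho>>real n. (\<rho> - real n) powr (\<alpha> - 1) * tail \<rho> \<le> \<delta>)"
    proof safe
      fix \<rho> assume *: "\<forall>x. \<bar>x\<bar> > real n \<longrightarrow> (\<bar>x\<bar> - real n) powr (\<alpha> - 1) * tail \<bar>x\<bar> \<le> \<delta>" and "\<rho> > real n"
      then have "\<bar>\<rho>\<bar> = \<rho>" by linarith
      then show "(\<rho> - real n) powr (\<alpha> - 1) * tail \<rho> \<le> \<delta>" using *[rule_format, of \<rho>] \<open>\<rho> > real n\<close> by simp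
    qed auto
    finally show ?thesis .
  qed
  have "tail_condition \<alpha> \<mu> \<longleftrightarrow> S \<longlonglongrightarrow> 0" by (simp add: tail_condition_def S_def[abs_def])
  also have "\<dots> \<longleftrightarrow> (\<forall>\<delta>>0. \<exists>n0. \<forall>n\<ge>n0. S n \<le> ennreal \<delta>)"
  proof
    assume "S \<longlonglongrightarrow> 0"
    show "\<forall>\<delta>>0. \<exists>n0. \<forall>n\<ge>n0. S n \<le> ennreal \<delta>"
    proof (intro allI impI)
      fix \<delta> :: real assume "\<delta> > 0"
      then have "eventually (\<lambda>n. S n < ennreal \<delta>) sequentially"
        by (intro order_tendstoD(2)[OF \<open>S \<longlonglongrightarrow> 0\<close>]) auto
      then show "\<exists>n0. \<forall>n\<ge>n0. S n \<le> ennreal \<delta>"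
        by (auto simp: eventually_sequentially intro: less_imp_le)
    qed
  next
    assume *: "\<forall>\<delta>>0. \<exists>n0. \<forall>n\<ge>n0. S n \<le> ennreal \<delta>"
    show "S \<longlonglongrightarrow> 0"
    proof (rule order_tendstoI)
      fix y :: ennreal assume "0 < y"
      then obtain d where d: "0 < d" "d < y" using dense by blast
      then have "d < top" using top.not_eq_extremum by fastforce
      then obtain \<delta> where "d = ennreal \<delta>" "\<delta> > 0" using d(1) by (cases d) auto
      with * obtain n0 where "\<forall>n\<ge>n0. S n \<le> d" by blast
      then show "eventually (\<lambda>n. S n < y) sequentially"
        using d(2) by (auto simp: eventually_sequentially intro: le_less_trans)
    qed auto
  qed
  also have "\<dots> \<longleftrightarrow> (\<forall>\<delta>>0. \<exists>n0::nat. \<forall>n\<ge>n0. \<forall>\<rho>>real n. (\<rho> - real n) powr (\<alpha> - 1) * tail \<rho> \<le> \<delta>)"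
    by (simp add: S cong: imp_cong)
  finally show ?thesis .
qed

lemma tail_imp_weak_super_Poincare:
  assumes "tail_condition \<alpha> \<mu>"
  shows "weak_super_Poincare \<alpha> \<mu>"
  unfolding weak_super_Poincare_def
proof (intro allI impI)
  fix r :: real assume r: "r > 0"
  let ?K = "hoelder_const \<alpha>" and ?C = "stable_const \<alpha>"
  have K: "?K > 0" using hoelder_const_pos alpha by blast
  have C: "?C > 0" using stable_const_pos alpha by simp
  \<comment> \<open>Chosen so that the Hardy constant \<open>16 * ?K * \<delta>\<close> is r C / 8;
    after the factor 2 from squaring a sum this is half of the coefficient r C / 2 belonging to
    \<open>r * \<E> f\<close>.\<close>
  define \<delta> where "\<delta> = r * ?C / (128 * ?K)"
  have \<delta>: "\<delta> > 0" using r K C by (simp add: \<delta>_def)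
  \<comment> \<open>Makes \<open>s\<^sup>2\<close> equal to (r C / 16) E; it enters with the factor
    4 and supplies the other half of \<open>r * \<E> f\<close>.\<close>
  define h where "h = (r * ?C / (16 * ?K)) powr (1 / (\<alpha> - 1))"
  have h: "h > 0" "h powr (\<alpha> - 1) = r * ?C / (16 * ?K)"
    using r K C alpha by (auto simp: h_def powr_powr)
  obtain n0 :: nat where n0: "\<forall>n\<ge>n0. \<forall>\<rho>>real n. (\<rho> - real n) powr (\<alpha> - 1) * tail \<rho> \<le> \<delta>"
    using assms \<delta> tail_condition_iff by blast
  \<comment> \<open>The successor guarantees n > 0, as the level set bound needs room inside
    [-n, n].\<close>
  define n where "n = real (Suc n0)"
  have n: "n > 0" "\<And>\<rho>. \<rho> > n \<Longrightarrow> (\<rho> - n) powr (\<alpha> - 1) * tail \<rho> \<le> \<delta>"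
    using n0 unfolding n_def by (auto simp del: of_nat_Suc)
  obtain m where m: "m > 0" "\<And>x. \<bar>x\<bar> \<le> n \<Longrightarrow> measure \<mu> {x..x + h} \<ge> m"
    using interval_measure_lower_bound[of n h] n h by auto
  show "\<exists>B. \<forall>f\<in>\<F>. (\<integral>x. (f x)\<^sup>2 \<partial>\<mu>) \<le> r * \<E> f + B * (\<integral>x. \<bar>f x\<bar> \<partial>\<mu>)\<^sup>2"
  proof (intro exI ballI)
    fix f assume F: "f \<in> \<F>"
    note f = domainD[OF F]
    note [measurable] = f(1)
    define E where "E = enn2real (energy \<alpha> f)"
    have E: "energy \<alpha> f = ennreal E" "E \<ge> 0" using f(3) by (auto simp: E_def)
    let ?I = "\<integral>x. \<bar>f x\<bar> \<partial>\<mu>"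
    define s where "s = sqrt (?K * h powr (\<alpha> - 1) * E)"
    define M where "M = ?I / m + s"
    have s: "s \<ge> 0" "s\<^sup>2 = r * ?C / 16 * E" using K r C E h by (auto simp: s_def)
    have M: "M \<ge> 0" using s m by (auto simp: M_def intro!: add_nonneg_nonneg divide_nonneg_pos)
    define g where "g x = max 0 (\<bar>f x\<bar> - M)" for x
    have [measurable]: "g \<in> borel_measurable borel" unfolding g_def by measurable
    have gF: "g \<in> \<F>" unfolding g_def using domain_excess(1)[OF F M] .
    have le: "\<bar>g x - g y\<bar> \<le> \<bar>f x - f y\<bar>" for x y unfolding g_def by linarith
    have "(\<integral>\<^sup>+x. ennreal ((g x)\<^sup>2) \<partial>\<mu>) \<le> ennreal (16 * ?K * \<delta> * E)"
    \<comment> \<open>The set \<open>D\<close> belongs to \<open>f\<close> and not to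
      \<open>g\<close>: the bound of |f| by \<open>M\<close> on [-n, n] is known exactly at the
      points where \<open>jump_energy\<close> of \<open>f\<close> is finite.\<close>
    proof (rule Hardy_inequality[where D="{x. jump_energy \<alpha> f x < \<infinity>}" and n=n])
      show "energy \<alpha> g \<le> ennreal E" using energy_mono[of g f \<alpha>, OF le] E(1) by auto
      show "AE x in lborel. x \<in> {x. jump_energy \<alpha> f x < \<infinity>}" using AE_jump_energy_finite[OF f(1,3)] by simp
      show "jump_energy \<alpha> g x < \<infinity>" if "x \<in> {x. jump_energy \<alpha> f x < \<infinity>}" for x
        using that jump_energy_mono[of g f \<alpha> x, OF le] by (auto intro: le_less_trans)
      show "g x = 0" if "x \<in> {x. jump_energy \<alpha> f x < \<infinity>}" "\<bar>x\<bar> \<le> n" for x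
        using local_sup_bound[OF F _ h(1) m(1) m(2)[OF that(2)]] that(1)
        by (auto simp: g_def M_def s_def E_def)
    qed (use n \<delta> E in \<open>auto simp: g_def\<close>)
    also have "(\<integral>\<^sup>+x. ennreal ((g x)\<^sup>2) \<partial>\<mu>) = ennreal (\<integral>x. (g x)\<^sup>2 \<partial>\<mu>)"
      by (rule nn_integral_eq_integral) (use domainD(2)[OF gF] in auto)
    finally have "(\<integral>x. (g x)\<^sup>2 \<partial>\<mu>) \<le> 16 * ?K * \<delta> * E"
      using K \<delta> E by (subst (asm) ennreal_le_iff) auto
    also have "16 * ?K * \<delta> * E = r * ?C / 8 * E" using K by (simp add: \<delta>_def)
    finally have gi: "(\<integral>x. (g x)\<^sup>2 \<partial>\<mu>) \<le> r * ?C / 8 * E" .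
    have pt: "(f x)\<^sup>2 \<le> 2 * (g x)\<^sup>2 + 2 * M\<^sup>2" for x
    proof -
      have "\<bar>f x\<bar> \<le> g x + M" by (simp add: g_def)
      then have "(f x)\<^sup>2 \<le> (g x + M)\<^sup>2" by (metis abs_ge_zero power2_abs power_mono)
      also have "\<dots> \<le> 2 * (g x)\<^sup>2 + 2 * M\<^sup>2"
        using zero_le_power2[of "g x - M"] by (simp add: power2_eq_square algebra_simps)
      finally show ?thesis .
    qed
    have "(\<integral>x. (f x)\<^sup>2 \<partial>\<mu>) \<le> (\<integral>x. 2 * (g x)\<^sup>2 + 2 * M\<^sup>2 \<partial>\<mu>)"
      using f(2) domainD(2)[OF gF] by (intro integral_mono pt) auto
    also have "\<dots> = 2 * (\<integral>x. (g x)\<^sup>2 \<partial>\<mu>) + 2 * M\<^sup>2"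
      using domainD(2)[OF gF] by simp
    also have "M\<^sup>2 \<le> 2 * (?I / m)\<^sup>2 + 2 * s\<^sup>2"
      using zero_le_power2[of "?I / m - s"] unfolding M_def by (simp add: power2_eq_square algebra_simps)
    finally have "(\<integral>x. (f x)\<^sup>2 \<partial>\<mu>) \<le> 2 * (r * ?C / 8 * E) + 2 * (2 * (?I / m)\<^sup>2 + 2 * s\<^sup>2)"
      using gi by linarith
    also have "\<dots> = r * (?C / 2 * E) + 4 / m\<^sup>2 * ?I\<^sup>2"
      unfolding s(2) by (simp add: power_divide)
    also have "?C / 2 * E = \<E> f" using alpha by (simp add: dirichlet_form_eq_energy E_def)
    finally show "(\<integral>x. (f x)\<^sup>2 \<partial>\<mu>) \<le> r * \<E> f + 4 / m\<^sup>2 * ?I\<^sup>2" .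
  qed
qed

end

section \<open>The energy of a ramp, computed by integrating over shifts\<close>

lemma energy_eq_difference:
  assumes [measurable]: "f \<in> borel_measurable borel"
  shows "energy \<alpha> f = (\<integral>\<^sup>+h. (\<integral>\<^sup>+y. ennreal ((f y - f (y + h))\<^sup>2 / \<bar>h\<bar> powr (1 + \<alpha>)) \<partial>lborel) \<partial>lborel)"
proof -
  have "jump_energy \<alpha> f x = (\<integral>\<^sup>+h. ennreal ((f x - f (x + h))\<^sup>2 / \<bar>h\<bar> powr (1 + \<alpha>)) \<partial>lborel)" for x
    unfolding jump_energy_def by (subst nn_integral_real_affine[where c=1 and t=x]) auto
  then have "energy \<alpha> f = (\<integral>\<^sup>+x. (\<integral>\<^sup>+h. ennreal ((f x - f (x + h))\<^sup>2 / \<bar>h\<bar> powr (1 + \<alpha>)) \<partial>lborel) \<partial>lborel)"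
    unfolding energy_def by (intro nn_integral_cong)
  also have "\<dots> = (\<integral>\<^sup>+h. (\<integral>\<^sup>+y. ennreal ((f y - f (y + h))\<^sup>2 / \<bar>h\<bar> powr (1 + \<alpha>)) \<partial>lborel) \<partial>lborel)"
    by (rule lborel_pair.Fubini') measurable
  finally show ?thesis .
qed

definition ramp :: "real \<Rightarrow> real \<Rightarrow> real \<Rightarrow> real" where
  "ramp n L y = min 1 (max 0 ((\<bar>y\<bar> - n) / L))"

lemma measurable_ramp [measurable]: "ramp n L \<in> borel_measurable borel"
  unfolding ramp_def by measurable

lemma ramp_bounds: "0 \<le> ramp n L y" "ramp n L y \<le> 1"
  by (auto simp: ramp_def)

lemma ramp_Lipschitz:
  assumes "L > 0"
  shows "\<bar>ramp n L x - ramp n L y\<bar> \<le> \<bar>x - y\<bar> / L"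
proof -
  have "\<bar>ramp n L x - ramp n L y\<bar> \<le> \<bar>(\<bar>x\<bar> - n) / L - (\<bar>y\<bar> - n) / L\<bar>"
    unfolding ramp_def by linarith
  also have "\<dots> = \<bar>\<bar>x\<bar> - \<bar>y\<bar>\<bar> / L" using assms by (simp add: abs_divide flip: diff_divide_distrib)
  also have "\<dots> \<le> \<bar>x - y\<bar> / L" using assms by (intro divide_right_mono) auto
  finally show ?thesis .
qed

lemma ramp_eq_0: "L > 0 \<Longrightarrow> \<bar>y\<bar> \<le> n \<Longrightarrow> ramp n L y = 0"
  by (simp add: ramp_def max_absorb1 divide_le_0_iff)

lemma ramp_eq_1: "L > 0 \<Longrightarrow> \<bar>y\<bar> \<ge> n + L \<Longrightarrow> ramp n L y = 1"
  by (simp add: ramp_def max_def min_def field_simps)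

lemma ramp_shift_eq:
  assumes "L > 0" "y \<notin> {n - \<bar>h\<bar>..n + L + \<bar>h\<bar>} \<union> {- (n + L + \<bar>h\<bar>).. - (n - \<bar>h\<bar>)}"
  shows "ramp n L y = ramp n L (y + h)"
proof -
  have "\<bar>y\<bar> < n - \<bar>h\<bar> \<or> \<bar>y\<bar> > n + L + \<bar>h\<bar>" using assms(2) by auto
  then show ?thesis
  proof
    assume "\<bar>y\<bar> < n - \<bar>h\<bar>"
    then have "\<bar>y\<bar> \<le> n" "\<bar>y + h\<bar> \<le> n" by linarith+
    then show ?thesis using ramp_eq_0[OF assms(1)] by simp
  next
    assume "\<bar>y\<bar> > n + L + \<bar>h\<bar>"
    then have "\<bar>y\<bar> \<ge> n + L" "\<bar>y + h\<bar> \<ge> n + L" by linarith+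
    then show ?thesis using ramp_eq_1[OF assms(1)] by simp
  qed
qed

text \<open>For a fixed shift \<open>h\<close> the kernel is constant. A point and its shift lie on
  the same plateau unless the point is within |h| of one of the two slopes, a set of measure at most
  2 (L + 2 |h|); there the difference is at most 1 and at most |h| / L.\<close>

lemma nn_integral_ramp_shift_le:
  assumes "L > 0"
  shows "(\<integral>\<^sup>+y. ennreal ((ramp n L y - ramp n L (y + h))\<^sup>2 / \<bar>h\<bar> powr (1 + \<alpha>)) \<partial>lborel)
    \<le> ennreal (min 1 (h\<^sup>2 / L\<^sup>2) / \<bar>h\<bar> powr (1 + \<alpha>) * (2 * (L + 2 * \<bar>h\<bar>)))"
proof -
  let ?A = "{n - \<bar>h\<bar>..n + L + \<bar>h\<bar>}" and ?B = "{- (n + L + \<bar>h\<bar>).. - (n - \<bar>h\<bar>)}"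
  let ?c = "min 1 (h\<^sup>2 / L\<^sup>2) / \<bar>h\<bar> powr (1 + \<alpha>)"
  have pt: "ennreal ((ramp n L y - ramp n L (y + h))\<^sup>2 / \<bar>h\<bar> powr (1 + \<alpha>)) \<le> ennreal ?c * indicator (?A \<union> ?B) y" for y
  proof (cases "y \<in> ?A \<union> ?B")
    case True
    have "\<bar>ramp n L y - ramp n L (y + h)\<bar> \<le> 1"
      using ramp_bounds[of n L y] ramp_bounds[of n L "y + h"] by linarith
    then have "(ramp n L y - ramp n L (y + h))\<^sup>2 \<le> 1" by (simp add: abs_square_le_1)
    moreover have "\<bar>ramp n L y - ramp n L (y + h)\<bar> \<le> \<bar>h\<bar> / L"
      using ramp_Lipschitz[OF assms, of n y "y + h"] by simp
    then have "\<bar>ramp n L y - ramp n L (y + h)\<bar>\<^sup>2 \<le> (\<bar>h\<bar> / L)\<^sup>2" by (intro power_mono) auto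
    then have "(ramp n L y - ramp n L (y + h))\<^sup>2 \<le> h\<^sup>2 / L\<^sup>2" by (simp add: power_divide)
    ultimately show ?thesis using True by (auto intro!: ennreal_leI divide_right_mono)
  next
    case False
    then show ?thesis using ramp_shift_eq[OF assms False] by simp
  qed
  have "(\<integral>\<^sup>+y. ennreal ((ramp n L y - ramp n L (y + h))\<^sup>2 / \<bar>h\<bar> powr (1 + \<alpha>)) \<partial>lborel)
     \<le> ennreal ?c * emeasure lborel (?A \<union> ?B)"
    by (subst nn_integral_cmult_indicator[symmetric]) (auto intro!: nn_integral_mono pt simp del: minus_add_distrib minus_diff_eq)
  also have "\<dots> \<le> ennreal ?c * (emeasure lborel ?A + emeasure lborel ?B)"
    by (intro mult_left_mono emeasure_subadditive) auto
  also have "emeasure lborel ?A + emeasure lborel ?B = ennreal (2 * (L + 2 * \<bar>h\<bar>))"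
    using assms by (subst (1 2) emeasure_lborel_Icc) (auto simp flip: ennreal_plus)
  also have "ennreal ?c * \<dots> = ennreal (?c * (2 * (L + 2 * \<bar>h\<bar>)))"
    by (rule ennreal_mult[symmetric]) (use assms in auto)
  finally show ?thesis .
qed

lemma nn_integral_even_le:
  fixes w :: "real \<Rightarrow> ennreal"
  assumes [measurable]: "w \<in> borel_measurable borel"
  shows "(\<integral>\<^sup>+h. w \<bar>h\<bar> \<partial>lborel) \<le> 2 * (\<integral>\<^sup>+h\<in>{0..}. w h \<partial>lborel)"
proof -
  have "(\<integral>\<^sup>+h. w \<bar>h\<bar> \<partial>lborel) \<le> (\<integral>\<^sup>+h. w h * indicator {0..} h + w (- h) * indicator {0..} (- h) \<partial>lborel)"
    by (intro nn_integral_mono) (auto simp: indicator_def abs_if)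
  also have "\<dots> = (\<integral>\<^sup>+h\<in>{0..}. w h \<partial>lborel) + (\<integral>\<^sup>+h. w (- h) * indicator {0..} (- h) \<partial>lborel)"
    by (rule nn_integral_add) auto
  also have "(\<integral>\<^sup>+h. w (- h) * indicator {0..} (- h) \<partial>lborel) = (\<integral>\<^sup>+h\<in>{0..}. w h \<partial>lborel)"
    by (subst (2) nn_integral_real_affine[where c="-1" and t=0]) auto
  finally show ?thesis by (simp add: mult_2)
qed

text \<open>Shifts are split at size L. For u \<le> L the integrand is at most (6 / L) u^(1 -
  \<alpha>), integrable at 0 since \<alpha> < 2; for u > L it is at most 6 u^(-\<alpha>), integrable
  at infinity since \<alpha> > 1. The two signs of \<open>h\<close> turn 6 into 12. The bound is
  uniform in \<open>n\<close>.\<close>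

lemma energy_ramp_le:
  assumes "L > 0" "1 < \<alpha>" "\<alpha> < 2"
  shows "energy \<alpha> (ramp n L) \<le> ennreal (12 * (1 / (2 - \<alpha>) + 1 / (\<alpha> - 1)) * L powr (1 - \<alpha>))"
proof -
  define w1 where "w1 u = ennreal (u powr (1 - \<alpha>)) * indicator {0..L} u" for u :: real
  define w2 where "w2 u = ennreal (u powr (- \<alpha>)) * indicator {L..} u" for u :: real
  define w where "w u = ennreal (6 / L) * w1 u + 6 * w2 u" for u
  have [measurable]: "w1 \<in> borel_measurable borel" "w2 \<in> borel_measurable borel" "w \<in> borel_measurable borel"
    unfolding w1_def w2_def w_def by measurable
  have pt: "ennreal (min 1 (h\<^sup>2 / L\<^sup>2) / \<bar>h\<bar> powr (1 + \<alpha>) * (2 * (L + 2 * \<bar>h\<bar>))) \<le> w \<bar>h\<bar>" for h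
  proof -
    define u where "u = \<bar>h\<bar>"
    consider "u = 0" | "0 < u" "u \<le> L" | "u > L" unfolding u_def by linarith
    then show ?thesis
    proof cases
      case 1
      then show ?thesis by (simp add: u_def)
    next
      case 2
      have "min 1 (h\<^sup>2 / L\<^sup>2) / u powr (1 + \<alpha>) * (2 * (L + 2 * u)) \<le> u\<^sup>2 / L\<^sup>2 / u powr (1 + \<alpha>) * (6 * L)"
        using 2 assms by (intro mult_mono[OF divide_right_mono, of _ _ _ "2 * (L + 2 * u)" "6 * L"]) (auto simp: u_def)
      also have "\<dots> = 6 / L * (u\<^sup>2 / u powr (1 + \<alpha>))"
        using assms by (simp add: power2_eq_square)
      also have "u\<^sup>2 / u powr (1 + \<alpha>) = u powr (1 - \<alpha>)"
        using 2 by (simp add: powr_diff powr_add power2_eq_square)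
      finally have "ennreal (min 1 (h\<^sup>2 / L\<^sup>2) / u powr (1 + \<alpha>) * (2 * (L + 2 * u))) \<le> ennreal (6 / L * u powr (1 - \<alpha>))"
        by (rule ennreal_leI)
      also have "\<dots> = ennreal (6 / L) * w1 u" using 2 assms by (subst ennreal_mult) (auto simp: w1_def)
      also have "\<dots> \<le> w u" by (simp add: w_def)
      finally show ?thesis by (simp add: u_def)
    next
      case 3
      have "min 1 (h\<^sup>2 / L\<^sup>2) / u powr (1 + \<alpha>) * (2 * (L + 2 * u)) \<le> 1 / u powr (1 + \<alpha>) * (6 * u)"
        using 3 assms by (intro mult_mono[OF divide_right_mono, of _ _ _ "2 * (L + 2 * u)" "6 * u"]) auto
      also have "\<dots> = 6 * u powr (- \<alpha>)"
        using 3 assms by (simp add: powr_add powr_minus field_simps)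
      finally have "ennreal (min 1 (h\<^sup>2 / L\<^sup>2) / u powr (1 + \<alpha>) * (2 * (L + 2 * u))) \<le> ennreal (6 * u powr (- \<alpha>))"
        by (rule ennreal_leI)
      also have "\<dots> = 6 * w2 u" using 3 assms by (simp add: w2_def ennreal_mult)
      also have "\<dots> \<le> w u" by (simp add: w_def)
      finally show ?thesis by (simp add: u_def)
    qed
  qed
  have I1: "(\<integral>\<^sup>+u. w1 u \<partial>lborel) = ennreal (L powr (2 - \<alpha>) / (2 - \<alpha>))"
    unfolding w1_def using has_integral_powr_from_0[of "1 - \<alpha>" L] assms
    by (intro nn_integral_has_integral_lebesgue') (auto simp: algebra_simps)
  have I2: "(\<integral>\<^sup>+u. w2 u \<partial>lborel) = ennreal (L powr (1 - \<alpha>) / (\<alpha> - 1))"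
    unfolding w2_def using has_integral_powr_to_inf[of "- \<alpha>" L] assms
    by (intro nn_integral_has_integral_lebesgue') (auto simp: minus_divide_right)
  have "energy \<alpha> (ramp n L) \<le> (\<integral>\<^sup>+h. w \<bar>h\<bar> \<partial>lborel)"
    unfolding energy_eq_difference[OF measurable_ramp]
    by (intro nn_integral_mono order_trans[OF nn_integral_ramp_shift_le pt] assms)
  also have "\<dots> \<le> 2 * (\<integral>\<^sup>+u\<in>{0..}. w u \<partial>lborel)" by (rule nn_integral_even_le) measurable
  also have "\<dots> \<le> 2 * (\<integral>\<^sup>+u. w u \<partial>lborel)"
    by (intro mult_left_mono nn_integral_mono) (auto simp: indicator_def)
  also have "(\<integral>\<^sup>+u. w u \<partial>lborel) = ennreal (6 / L) * (\<integral>\<^sup>+u. w1 u \<partial>lborel) + 6 * (\<integral>\<^sup>+u. w2 u \<partial>lborel)"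
    unfolding w_def by (subst nn_integral_add) (auto simp: nn_integral_cmult)
  also have "\<dots> = ennreal (6 / L * (L powr (2 - \<alpha>) / (2 - \<alpha>)) + 6 * (L powr (1 - \<alpha>) / (\<alpha> - 1)))"
    unfolding I1 I2 using assms
    by (simp only: ennreal_numeral[symmetric]) (simp add: ennreal_mult[symmetric] ennreal_plus[symmetric] del: ennreal_numeral ennreal_plus)
  also have "2 * \<dots> = ennreal (2 * (6 / L * (L powr (2 - \<alpha>) / (2 - \<alpha>)) + 6 * (L powr (1 - \<alpha>) / (\<alpha> - 1))))"
    using assms by (subst ennreal_mult) auto
  also have "2 * (6 / L * (L powr (2 - \<alpha>) / (2 - \<alpha>)) + 6 * (L powr (1 - \<alpha>) / (\<alpha> - 1)))
     = 12 * (L powr (2 - \<alpha>) / L / (2 - \<alpha>) + L powr (1 - \<alpha>) / (\<alpha> - 1))"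
    by (simp add: distrib_left)
  also have "L powr (2 - \<alpha>) / L = L powr (1 - \<alpha>)"
    using assms by (simp add: powr_diff power2_eq_square)
  also have "12 * (L powr (1 - \<alpha>) / (2 - \<alpha>) + L powr (1 - \<alpha>) / (\<alpha> - 1))
     = 12 * (1 / (2 - \<alpha>) + 1 / (\<alpha> - 1)) * L powr (1 - \<alpha>)"
    by (simp add: algebra_simps add_divide_distrib)
  finally show ?thesis .
qed

section \<open>The weak form implies the tail condition\<close>

context time_changed_stable
begin

text \<open>Cauchy-Schwarz against the indicator of the support, read off from the nonnegative
  integral of (T g - m 1_A)^2, where T is the mass of \<open>A\<close> and m the integral of
  \<open>g\<close>.\<close>

lemma square_integral_le_support:
  assumes [measurable]: "g \<in> borel_measurable borel" "A \<in> sets borel"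
    and "integrable \<mu> g" "integrable \<mu> (\<lambda>x. (g x)\<^sup>2)" and off: "\<And>x. x \<notin> A \<Longrightarrow> g x = 0"
  shows "(\<integral>x. g x \<partial>\<mu>)\<^sup>2 \<le> (\<integral>x. (g x)\<^sup>2 \<partial>\<mu>) * measure \<mu> A"
proof -
  define T where "T = measure \<mu> A"
  let ?m = "\<integral>x. g x \<partial>\<mu>" and ?Q = "\<integral>x. (g x)\<^sup>2 \<partial>\<mu>"
  show ?thesis
  proof (cases "T = 0")
    case True
    then have "AE x in \<mu>. x \<notin> A"
      by (subst AE_iff_measurable[of A]) (auto simp: T_def emeasure_eq_measure)
    then have "AE x in \<mu>. g x = 0" by eventually_elim (rule off)
    then have "?m = 0" by (rule integral_eq_zero_AE)
    then show ?thesis by simp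
  next
    case False
    then have T: "T > 0" by (simp add: T_def zero_less_measure_iff)
    have iA: "integrable \<mu> (indicator A :: real \<Rightarrow> real)" by (auto simp: emeasure_eq_measure)
    have "0 \<le> (\<integral>x. (T * g x - ?m * indicator A x)\<^sup>2 \<partial>\<mu>)" by (rule integral_nonneg_AE) auto
    also have "\<dots> = (\<integral>x. T\<^sup>2 * (g x)\<^sup>2 - 2 * T * ?m * g x + ?m\<^sup>2 * indicator A x \<partial>\<mu>)"
      by (intro Bochner_Integration.integral_cong)
         (use off in \<open>auto simp: power2_eq_square algebra_simps indicator_def\<close>)
    also have "\<dots> = T\<^sup>2 * ?Q - 2 * T * ?m * ?m + ?m\<^sup>2 * T"
      using assms(3,4) iA by (simp add: T_def)
    also have "\<dots> = T * (?Q * T - ?m\<^sup>2)" by (simp add: power2_eq_square algebra_simps)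
    finally show ?thesis using T by (simp add: zero_le_mult_iff T_def)
  qed
qed

lemma tail_tendsto_0: "(\<lambda>n. tail (real n)) \<longlonglongrightarrow> 0"
proof -
  have "(\<lambda>n. measure \<mu> (- {- real n<..<real n})) \<longlonglongrightarrow> measure \<mu> (\<Inter>n. - {- real n<..<real n})"
    by (rule finite_Lim_measure_decseq) (auto simp: decseq_def)
  also have "(\<Inter>n. - {- real n<..<real n}) = {}"
  proof -
    have "\<exists>n. x \<in> {- real n<..<real n}" for x :: real
      using reals_Archimedean2[of "\<bar>x\<bar>"] by (auto simp: abs_less_iff) (metis minus_less_iff)
    then show ?thesis by blast
  qed
  finally show ?thesis by (simp add: tail_def)
qed

lemma weak_super_Poincare_pos_rate:
  assumes "weak_super_Poincare \<alpha> \<mu>" "r > 0"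
  obtains B where "B > 0" "\<And>f. f \<in> \<F> \<Longrightarrow> (\<integral>x. (f x)\<^sup>2 \<partial>\<mu>) \<le> r * \<E> f + B * (\<integral>x. \<bar>f x\<bar> \<partial>\<mu>)\<^sup>2"
proof -
  obtain \<beta> where "super_Poincare \<alpha> \<mu> \<beta>" using assms super_Poincare_iff_weak by blast
  then show ?thesis using assms(2) that[of "\<beta> r"] unfolding super_Poincare_def by blast
qed

text \<open>Once \<open>tail n\<close> is below 1 / (2 B), Cauchy-Schwarz makes the L1 term at most
  half of the L2 term, so it can be absorbed. The threshold depends only on \<open>B\<close>, hence
  on \<delta>, and so serves all \<rho> at once. The ramp of width \<rho> - n equals 1 where |y|
  \<ge> \<rho>, so its L2 norm dominates \<open>tail \<rho>\<close>.\<close>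

lemma weak_super_Poincare_imp_tail:
  assumes "weak_super_Poincare \<alpha> \<mu>"
  shows "tail_condition \<alpha> \<mu>"
  unfolding tail_condition_iff
proof (intro allI impI)
  fix \<delta> :: real assume \<delta>: "\<delta> > 0"
  define c where "c = 12 * (1 / (2 - \<alpha>) + 1 / (\<alpha> - 1))"
  have c: "c > 0" using alpha by (auto simp: c_def intro!: add_pos_pos)
  let ?C = "stable_const \<alpha>"
  have C: "?C > 0" using stable_const_pos alpha by simp
  \<comment> \<open>Absorption doubles \<open>r\<close>, which cancels the 1 / 2 of the form; with
    this value exactly \<delta> L^(1 - \<alpha>) remains.\<close>
  define r where "r = \<delta> / (?C * c)"
  have r: "r > 0" using \<delta> C c by (simp add: r_def)
  obtain B where B: "B > 0" "\<And>f. f \<in> \<F> \<Longrightarrow> (\<integral>x. (f x)\<^sup>2 \<partial>\<mu>) \<le> r * \<E> f + B * (\<integral>x. \<bar>f x\<bar> \<partial>\<mu>)\<^sup>2"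
    using weak_super_Poincare_pos_rate[OF assms r] by blast
  have "eventually (\<lambda>n. tail (real n) < 1 / (2 * B)) sequentially"
    using B(1) by (intro order_tendstoD(2)[OF tail_tendsto_0]) auto
  then obtain n0 where n0: "\<And>n. n \<ge> n0 \<Longrightarrow> tail (real n) < 1 / (2 * B)"
    by (auto simp: eventually_sequentially)
  show "\<exists>n0::nat. \<forall>n\<ge>n0. \<forall>\<rho>>real n. (\<rho> - real n) powr (\<alpha> - 1) * tail \<rho> \<le> \<delta>"
  proof (intro exI[of _ n0] allI impI)
    fix n and \<rho> :: real assume n: "n \<ge> n0" "\<rho> > real n"
    define L where "L = \<rho> - real n"
    have L: "L > 0" using n by (simp add: L_def)
    let ?\<phi> = "ramp (real n) L"
    have b2: "(?\<phi> y)\<^sup>2 \<le> 1" for y using ramp_bounds[of "real n" L y] by (simp add: power_le_one)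
    have i2: "integrable \<mu> (\<lambda>y. (?\<phi> y)\<^sup>2)"
      by (rule integrable_const_bound[where B=1]) (use b2 in auto)
    have en: "energy \<alpha> ?\<phi> \<le> ennreal (c * L powr (1 - \<alpha>))"
      using energy_ramp_le[OF L alpha] by (simp add: c_def)
    have F: "?\<phi> \<in> \<F>" using i2 en ennreal_less_top by (auto simp: domain_iff intro: le_less_trans)
    have "enn2real (energy \<alpha> ?\<phi>) \<le> c * L powr (1 - \<alpha>)"
      using enn2real_mono[OF en] c by simp
    then have E: "\<E> ?\<phi> \<le> ?C / 2 * (c * L powr (1 - \<alpha>))"
      using alpha C by (simp add: dirichlet_form_eq_energy)
    let ?Q = "\<integral>y. (?\<phi> y)\<^sup>2 \<partial>\<mu>"
    have "(\<integral>y. \<bar>?\<phi> y\<bar> \<partial>\<mu>)\<^sup>2 = (\<integral>y. ?\<phi> y \<partial>\<mu>)\<^sup>2" using ramp_bounds by simp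
    also have "\<dots> \<le> ?Q * tail (real n)"
      unfolding tail_def using domain_abs_integrable[OF F] i2 L
      by (intro square_integral_le_support) (auto intro!: ramp_eq_0)
    also have "\<dots> \<le> ?Q * (1 / (2 * B))" using n0[OF n(1)] by (intro mult_left_mono) auto
    finally have "B * (\<integral>y. \<bar>?\<phi> y\<bar> \<partial>\<mu>)\<^sup>2 \<le> B * (?Q * (1 / (2 * B)))"
      using B(1) by (intro mult_left_mono) auto
    also have "\<dots> = ?Q / 2" using B(1) by simp
    finally have "?Q \<le> 2 * (r * \<E> ?\<phi>)" using B(2)[OF F] by simp
    also have "\<dots> \<le> 2 * (r * (?C / 2 * (c * L powr (1 - \<alpha>))))"
      using r by (intro mult_left_mono E) auto
    also have "\<dots> = \<delta> * L powr (1 - \<alpha>)" using C c by (simp add: r_def)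
    finally have Q: "?Q \<le> \<delta> * L powr (1 - \<alpha>)" .
    have "tail \<rho> = (\<integral>y. indicator (- {-\<rho><..<\<rho>}) y \<partial>\<mu>)" by (simp add: tail_def)
    also have "\<dots> \<le> ?Q"
    proof (rule integral_mono)
      fix y :: real
      show "indicator (- {-\<rho><..<\<rho>}) y \<le> (?\<phi> y)\<^sup>2"
      proof (cases "y \<in> - {-\<rho><..<\<rho>}")
        case True
        then have "\<bar>y\<bar> \<ge> real n + L" by (auto simp: L_def)
        then show ?thesis using ramp_eq_1[OF L, of "real n" y] True by simp
      qed simp
    qed (use i2 in \<open>auto simp: emeasure_eq_measure\<close>)
    finally have "L powr (\<alpha> - 1) * tail \<rho> \<le> L powr (\<alpha> - 1) * (\<delta> * L powr (1 - \<alpha>))"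
      using Q by (intro mult_left_mono) auto
    also have "\<dots> = \<delta> * L powr ((\<alpha> - 1) + (1 - \<alpha>))" by (simp only: powr_add) simp
    also have "\<dots> = \<delta>" using L by simp
    finally show "(\<rho> - real n) powr (\<alpha> - 1) * tail \<rho> \<le> \<delta>" by (simp add: L_def)
  qed
qed

section \<open>From the weak form to the F-Sobolev inequality\<close>

text \<open>The part of a normalized function above a high level has small mass, so the \<open>L\<^sup>1\<close> term can be absorbed.\<close>
lemma excess_bound:
  assumes "weak_super_Poincare \<alpha> \<mu>" "\<epsilon> > 0"
  obtains t where "t \<ge> b" "t > 0"
    "\<And>f. f \<in> \<F> \<Longrightarrow> (\<integral>x. (f x)\<^sup>2 \<partial>\<mu>) = 1 \<Longrightarrow> (\<integral>x. (max 0 (\<bar>f x\<bar> - t))\<^sup>2 \<partial>\<mu>) \<le> \<epsilon> * \<E> f"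
proof -
  have "\<epsilon> / 2 > 0" using assms(2) by simp
  from weak_super_Poincare_pos_rate[OF assms(1) this]
  obtain B where B: "B > 0" "\<And>f. f \<in> \<F> \<Longrightarrow> (\<integral>x. (f x)\<^sup>2 \<partial>\<mu>) \<le> \<epsilon> / 2 * \<E> f + B * (\<integral>x. \<bar>f x\<bar> \<partial>\<mu>)\<^sup>2"
    by blast
  \<comment> \<open>By Chebyshev the set where |f| > t has mass at most 1 / t^2, hence at most 1 /
    (2 B). Half of the L2 term is then absorbed, which turns the rate \<epsilon> / 2 into
    \<epsilon>.\<close>
  define t where "t = max b (sqrt (2 * B))"
  have t: "t \<ge> b" "t \<ge> sqrt (2 * B)" by (auto simp: t_def)
  have t0: "t > 0" using t(2) B(1) by (intro less_le_trans[OF _ t(2)]) simp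
  have t2: "2 * B \<le> t\<^sup>2" using t(2) B(1) by (meson real_le_lsqrt real_sqrt_le_iff less_imp_le sqrt_le_D)
  have "(\<integral>x. (max 0 (\<bar>f x\<bar> - t))\<^sup>2 \<partial>\<mu>) \<le> \<epsilon> * \<E> f" if F: "f \<in> \<F>" and f1: "(\<integral>x. (f x)\<^sup>2 \<partial>\<mu>) = 1" for f
  proof -
    note [measurable] = domainD(1)[OF F]
    define g where "g x = max 0 (\<bar>f x\<bar> - t)" for x
    have [measurable]: "g \<in> borel_measurable borel" unfolding g_def by measurable
    have g: "g \<in> \<F>" "\<E> g \<le> \<E> f"
      using domain_excess[OF F, of t] t0 by (auto simp: g_def[abs_def])
    define A where "A = {x. \<bar>f x\<bar> > t}"
    have [measurable]: "A \<in> sets borel" unfolding A_def by measurable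
    have "t\<^sup>2 * measure \<mu> A = (\<integral>x. t\<^sup>2 * indicator A x \<partial>\<mu>)" by simp
    also have "\<dots> \<le> (\<integral>x. (f x)\<^sup>2 \<partial>\<mu>)"
    proof (rule integral_mono)
      fix x
      show "t\<^sup>2 * indicator A x \<le> (f x)\<^sup>2"
      proof (cases "x \<in> A")
        case True
        then have "t\<^sup>2 \<le> \<bar>f x\<bar>\<^sup>2" using t0 by (intro power_mono) (auto simp: A_def)
        then show ?thesis using True by simp
      qed simp
    qed (use domainD(2)[OF F] in \<open>auto simp: emeasure_eq_measure\<close>)
    finally have "2 * B * measure \<mu> A \<le> 1"
      using f1 mult_right_mono[OF t2, of "measure \<mu> A"] by simp
    then have A: "B * measure \<mu> A \<le> 1 / 2" by simp
    let ?Q = "\<integral>x. (g x)\<^sup>2 \<partial>\<mu>"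
    have "(\<integral>x. \<bar>g x\<bar> \<partial>\<mu>)\<^sup>2 = (\<integral>x. g x \<partial>\<mu>)\<^sup>2" by (simp add: g_def)
    also have "\<dots> \<le> ?Q * measure \<mu> A"
      using domain_abs_integrable[OF g(1)] domainD(2)[OF g(1)]
      by (intro square_integral_le_support) (auto simp: g_def A_def)
    finally have "B * (\<integral>x. \<bar>g x\<bar> \<partial>\<mu>)\<^sup>2 \<le> B * (?Q * measure \<mu> A)"
      using B(1) by (intro mult_left_mono) auto
    also have "\<dots> = ?Q * (B * measure \<mu> A)" by simp
    also have "\<dots> \<le> ?Q * (1 / 2)" by (intro mult_left_mono A) auto
    finally have "?Q \<le> \<epsilon> * \<E> g" using B(2)[OF g(1)] by simp
    also have "\<dots> \<le> \<epsilon> * \<E> f" using g(2) assms(2) by simp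
    finally show ?thesis by (simp add: g_def)
  qed
  then show ?thesis using that t(1) t0 by blast
qed

text \<open>\<open>F\<close> is built so that f^2 F(f^2) is the sum over j of the squared excesses
  of |f| over t_j. Each excess integral is at most 2^-j times the form, so the series
  converges.\<close>

lemma weak_imp_F_Sobolev:
  assumes "weak_super_Poincare \<alpha> \<mu>"
  shows "\<exists>F. F_Sobolev \<alpha> \<mu> F"
proof -
  \<comment> \<open>The requirement t_j \<ge> j + 1 leaves only finitely many nonzero terms near
    each s > 0, which gives continuity; t_0 \<ge> 1 makes \<open>F\<close> vanish on (0, 1].\<close>
  have "\<exists>t. t \<ge> real (Suc j) \<and> (\<forall>f\<in>\<F>. (\<integral>x. (f x)\<^sup>2 \<partial>\<mu>) = 1 \<longrightarrow>
      (\<integral>x. (max 0 (\<bar>f x\<bar> - t))\<^sup>2 \<partial>\<mu>) \<le> (1 / 2) ^ j * \<E> f)" for j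
  proof -
    have "(1 / 2 :: real) ^ j > 0" by simp
    from excess_bound[OF assms this, of "real (Suc j)"] show ?thesis by metis
  qed
  then obtain t where t: "\<And>j. t j \<ge> real (Suc j)"
    and ex: "\<And>j f. f \<in> \<F> \<Longrightarrow> (\<integral>x. (f x)\<^sup>2 \<partial>\<mu>) = 1 \<Longrightarrow>
      (\<integral>x. (max 0 (\<bar>f x\<bar> - t j))\<^sup>2 \<partial>\<mu>) \<le> (1 / 2) ^ j * \<E> f"
    by metis
  have t0: "t j > 0" for j using t[of j] by linarith
  define h where "h j s = (max 0 (1 - t j / sqrt s))\<^sup>2" for j and s :: real
  define F where "F s = (\<Sum>j. h j s)" for s
  have [measurable]: "F \<in> borel_measurable borel" unfolding F_def h_def by measurable
  have h0: "h j s = 0" if "s > 0" "sqrt s \<le> real N" "j \<ge> N" for j s N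
  proof -
    have "sqrt s \<le> t j" using that t[of j] by linarith
    then show ?thesis using that(1) by (simp add: h_def)
  qed
  have F_eq: "F s = (\<Sum>j<N. h j s)" if "s > 0" "sqrt s \<le> real N" for s N
    unfolding F_def using h0[OF that] by (intro suminf_finite) auto
  have h_mono: "h j s \<le> h j s'" if "0 < s" "s \<le> s'" for j s s'
  proof -
    have "t j / sqrt s' \<le> t j / sqrt s" using that t0[of j] by (intro divide_left_mono) auto
    then show ?thesis unfolding h_def by (intro power_mono) auto
  qed
  \<comment> \<open>On the neighbourhood (0, N^2) of \<open>s\<close> the series is the same finite
    sum.\<close>
  have cont: "isCont F s" if "s > 0" for s
  proof -
    obtain N where N: "sqrt s < real N" using reals_Archimedean2 by blast
    have "s < (real N)\<^sup>2" using N that by (metis real_sqrt_less_iff real_sqrt_abs abs_of_nat)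
    then have "eventually (\<lambda>u. u \<in> {0<..<(real N)\<^sup>2}) (nhds s)"
      using that by (intro eventually_nhds_in_open) auto
    then have "eventually (\<lambda>u. F u = (\<Sum>j<N. h j u)) (nhds s)"
    proof eventually_elim
      case (elim u)
      then show ?case by (intro F_eq) (auto simp: real_le_lsqrt)
    qed
    moreover have "isCont (\<lambda>u. \<Sum>j<N. h j u) s"
      unfolding h_def using that by (intro continuous_intros) auto
    ultimately show ?thesis by (subst isCont_cong)
  qed
  have pt: "(\<Sum>j. ennreal ((max 0 (\<bar>u\<bar> - t j))\<^sup>2)) = ennreal (u\<^sup>2 * F (u\<^sup>2))" "u\<^sup>2 * F (u\<^sup>2) \<ge> 0" for u
  proof -
    \<comment> \<open>The case u = 0 stands apart: division by 0 gives \<open>h j 0 = 1\<close>, so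
      the series for \<open>F 0\<close> diverges, but it is only ever multiplied by u^2 = 0.\<close>
    have eq: "u\<^sup>2 * h j (u\<^sup>2) = (max 0 (\<bar>u\<bar> - t j))\<^sup>2" for j
    proof (cases "u = 0")
      case False
      have "\<bar>u\<bar> * max 0 (1 - t j / \<bar>u\<bar>) = max 0 (\<bar>u\<bar> - t j)"
        using False by (auto simp: max_def field_simps)
      then have "(\<bar>u\<bar> * max 0 (1 - t j / \<bar>u\<bar>))\<^sup>2 = (max 0 (\<bar>u\<bar> - t j))\<^sup>2" by simp
      then show ?thesis by (simp add: h_def power_mult_distrib)
    qed (use t0[of j] in auto)
    obtain N where N: "\<bar>u\<bar> \<le> real N" using real_arch_simple by blast
    have Fu: "u\<^sup>2 * F (u\<^sup>2) = (\<Sum>j<N. (max 0 (\<bar>u\<bar> - t j))\<^sup>2)"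
    proof (cases "u = 0")
      case True
      have "max 0 (- t j) = 0" for j using t0[of j] by simp
      then show ?thesis using True by simp
    next
      case False
      then have "F (u\<^sup>2) = (\<Sum>j<N. h j (u\<^sup>2))" using N by (intro F_eq) auto
      then show ?thesis by (simp add: sum_distrib_left eq)
    qed
    have "(\<Sum>j. ennreal ((max 0 (\<bar>u\<bar> - t j))\<^sup>2)) = (\<Sum>j<N. ennreal ((max 0 (\<bar>u\<bar> - t j))\<^sup>2))"
    proof (rule suminf_finite)
      fix j assume "j \<notin> {..<N}"
      then have "\<bar>u\<bar> \<le> t j" using N t[of j] by simp
      then show "ennreal ((max 0 (\<bar>u\<bar> - t j))\<^sup>2) = 0" by simp
    qed simp
    also have "\<dots> = ennreal (u\<^sup>2 * F (u\<^sup>2))" by (simp add: Fu sum_ennreal)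
    finally show "(\<Sum>j. ennreal ((max 0 (\<bar>u\<bar> - t j))\<^sup>2)) = ennreal (u\<^sup>2 * F (u\<^sup>2))" .
    show "u\<^sup>2 * F (u\<^sup>2) \<ge> 0" unfolding Fu by (intro sum_nonneg) auto
  qed
  have "F_Sobolev \<alpha> \<mu> F"
    unfolding F_Sobolev_def
  proof (intro conjI)
    show "continuous_on {0<..} F" using cont by (auto intro!: continuous_at_imp_continuous_on)
    show "mono_on {0<..} F"
    proof (rule mono_onI)
      fix s s' :: real assume s: "s \<in> {0<..}" "s' \<in> {0<..}" "s \<le> s'"
      obtain N where N: "sqrt s' \<le> real N" using real_arch_simple by blast
      then have "sqrt s \<le> real N" using s by (meson order_trans real_sqrt_le_mono)
      then show "F s \<le> F s'" using F_eq N s by (auto intro!: sum_mono h_mono)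
    qed
    have "\<bar>r * F r\<bar> \<le> 0" if "r \<in> {0<..1}" for r
    proof -
      have "F r = h 0 r" using F_eq[of r 1] that by simp
      also have "\<dots> = 0"
      proof -
        have "sqrt r \<le> 1" using that by simp
        then have "sqrt r \<le> t 0" using t[of 0] by linarith
        then show ?thesis using that by (simp add: h_def)
      qed
      finally show ?thesis by simp
    qed
    then show "bdd_above ((\<lambda>r. \<bar>r * F r\<bar>) ` {0<..1})" by (rule bdd_aboveI2)
    show "filterlim F at_top at_top"
      unfolding filterlim_at_top
    proof
      fix Z :: real
      \<comment> \<open>Each of the first \<open>M\<close> terms is at least 1 / 4 as soon as sqrt s
        \<ge> 2 t_j.\<close>
      obtain M where M: "4 * Z \<le> real M" using real_arch_simple by blast
      have "eventually (\<lambda>s. \<forall>j\<in>{..<M}. s \<ge> (2 * t j)\<^sup>2) at_top"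
        by (intro eventually_ball_finite ballI eventually_ge_at_top) auto
      moreover have "eventually (\<lambda>s::real. s > 0) at_top" by (rule eventually_gt_at_top)
      ultimately show "eventually (\<lambda>s. Z \<le> F s) at_top"
      proof eventually_elim
        case (elim s)
        have quarter: "1 / 4 \<le> h j s" if "j < M" for j
        proof -
          have "2 * t j \<le> sqrt s" using elim that by (intro real_le_rsqrt) auto
          then have "t j / sqrt s \<le> 1 / 2" using elim by (simp add: field_simps)
          then have "1 / 2 \<le> max 0 (1 - t j / sqrt s)" by linarith
          then have "(1 / 2)\<^sup>2 \<le> h j s" unfolding h_def by (rule power_mono) simp
          then show ?thesis by (simp add: power2_eq_square)
        qed
        obtain N where N: "sqrt s \<le> real N" using real_arch_simple by blast
        have "Z \<le> (\<Sum>j<M. 1 / 4)" using M by simp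
        also have "\<dots> \<le> (\<Sum>j<M. h j s)" using quarter by (intro sum_mono) auto
        also have "\<dots> \<le> (\<Sum>j<max M N. h j s)" by (intro sum_mono2) (auto simp: h_def)
        also have "\<dots> = F s" using elim N by (intro F_eq[symmetric]) auto
        finally show ?case .
      qed
    qed
    show "\<exists>C1>0. \<exists>C2\<ge>0. \<forall>f\<in>\<F>. (\<integral>x. (f x)\<^sup>2 \<partial>\<mu>) = 1 \<longrightarrow>
        integrable \<mu> (\<lambda>x. (f x)\<^sup>2 * F ((f x)\<^sup>2)) \<and>
        (\<integral>x. (f x)\<^sup>2 * F ((f x)\<^sup>2) \<partial>\<mu>) \<le> C1 * \<E> f + C2"
    \<comment> \<open>C1 = 2 is the sum of the series 2^-j, and C2 = 0 because no excess bound
      carries an additive constant.\<close>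
    proof (rule exI[of _ 2], intro exI[of _ 0] conjI ballI impI)
      fix f assume f: "f \<in> \<F>" "(\<integral>x. (f x)\<^sup>2 \<partial>\<mu>) = 1"
      note [measurable] = domainD(1)[OF f(1)]
      have Ef: "\<E> f \<ge> 0" by (rule form_nonneg) measurable
      have "(\<integral>\<^sup>+x. ennreal ((f x)\<^sup>2 * F ((f x)\<^sup>2)) \<partial>\<mu>) = (\<Sum>j. \<integral>\<^sup>+x. ennreal ((max 0 (\<bar>f x\<bar> - t j))\<^sup>2) \<partial>\<mu>)"
        by (subst nn_integral_suminf[symmetric]) (auto simp: pt(1))
      also have "\<dots> \<le> (\<Sum>j. ennreal ((1 / 2) ^ j * \<E> f))"
      proof (rule suminf_le)
        fix j
        have "integrable \<mu> (\<lambda>x. (max 0 (\<bar>f x\<bar> - t j))\<^sup>2)"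
          using domainD(2)[OF domain_excess(1)[OF f(1), of "t j"]] t0[of j] by simp
        then show "(\<integral>\<^sup>+x. ennreal ((max 0 (\<bar>f x\<bar> - t j))\<^sup>2) \<partial>\<mu>) \<le> ennreal ((1 / 2) ^ j * \<E> f)"
          using ex[OF f, of j] by (subst nn_integral_eq_integral) (auto intro: ennreal_leI)
      qed auto
      also have "\<dots> = ennreal (\<Sum>j. (1 / 2) ^ j * \<E> f)"
        using Ef by (intro suminf_ennreal2) (auto intro!: summable_mult2 summable_geometric)
      also have "(\<Sum>j. (1 / 2) ^ j * \<E> f) = 2 * \<E> f"
        using suminf_mult2[of "\<lambda>j. (1 / 2) ^ j" "\<E> f"] suminf_geometric[of "1 / 2 :: real"]
          summable_geometric[of "1 / 2 :: real"] by simp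
      finally have le: "(\<integral>\<^sup>+x. ennreal ((f x)\<^sup>2 * F ((f x)\<^sup>2)) \<partial>\<mu>) \<le> ennreal (2 * \<E> f)" .
      show "integrable \<mu> (\<lambda>x. (f x)\<^sup>2 * F ((f x)\<^sup>2))"
        using le ennreal_less_top[of "2 * \<E> f"] by (intro integrableI_nonneg) (auto simp: pt(2) intro: le_less_trans)
      then show "(\<integral>x. (f x)\<^sup>2 * F ((f x)\<^sup>2) \<partial>\<mu>) \<le> 2 * \<E> f + 0"
        using le Ef nn_integral_eq_integral[of \<mu> "\<lambda>x. (f x)\<^sup>2 * F ((f x)\<^sup>2)"]
        by (simp add: pt(2) ennreal_le_iff)
    qed auto
  qed
  then show ?thesis by blast
qed

lemma super_Poincare_iff_tail: "(\<exists>\<beta>. super_Poincare \<alpha> \<mu> \<beta>) \<longleftrightarrow> tail_condition \<alpha> \<mu>"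
  using super_Poincare_iff_weak tail_imp_weak_super_Poincare weak_super_Poincare_imp_tail by blast

lemma F_Sobolev_iff_tail: "(\<exists>F. F_Sobolev \<alpha> \<mu> F) \<longleftrightarrow> tail_condition \<alpha> \<mu>"
  using F_Sobolev_imp_weak weak_imp_F_Sobolev tail_imp_weak_super_Poincare weak_super_Poincare_imp_tail
  by blast

lemma Nash_type_iff_tail: "(\<exists>\<theta>. Nash_type \<alpha> \<mu> \<theta>) \<longleftrightarrow> tail_condition \<alpha> \<mu>"
  using Nash_type_imp_weak weak_imp_Nash_type tail_imp_weak_super_Poincare weak_super_Poincare_imp_tail
  by blast

end

theorem theorem1p5:
  fixes \<alpha> :: real and a :: "real \<Rightarrow> real"
  assumes "1 < \<alpha>" and "\<alpha> < 2"
    and "continuous_on UNIV a" and "\<And>x. a x > 0"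
    and "has_bochner_integral lborel (\<lambda>x. 1 / a x) 1"
  shows "((\<exists>\<beta>. super_Poincare \<alpha> (speed_measure a) \<beta>) \<longleftrightarrow> tail_condition \<alpha> (speed_measure a)) \<and>
         ((\<exists>F. F_Sobolev \<alpha> (speed_measure a) F) \<longleftrightarrow> tail_condition \<alpha> (speed_measure a)) \<and>
         ((\<exists>\<theta>. Nash_type \<alpha> (speed_measure a) \<theta>) \<longleftrightarrow> tail_condition \<alpha> (speed_measure a))"
proof -
  interpret time_changed_stable \<alpha> a by (unfold_locales) (use assms in auto)
  show ?thesis
    using super_Poincare_iff_tail F_Sobolev_iff_tail Nash_type_iff_tail by blast
qed

end
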